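(* Let $\lambda$ be a strict partition and let $n$ be a positive integer. Let $\Delta=(\Delta_1,\dots,\Delta_\ell)$ (with $\Delta_\ell>0$) be the largest D-partition contained in $\lambda$. Then the degree (in $x_1,\dots,x_n$) of the $P$-Grothendieck polynomial $GP_{\lambda,n}$ is \[ \deg(GP_{\lambda,n}) = \begin{cases} |\Delta| + 2n\ell-\ell^2-\ell, & \text{if } \Delta_\ell > 1; \\ |\Delta|+2n\ell-\ell^2-n, & \text{if } \Delta_\ell = 1. \end{cases} \]
   Context: A strict partition is $\lambda=(\lambda_1>\lambda_2>\dots>\lambda_m>0)$; $|\lambda|=\sum\lambda_i$ and $\ell(\lambda)=m$. A D-partition is a partition whose consecutive parts satisfy $\lambda_{i-1}-\lambda_i\ge 2$ for all $i$; containment of partitions means $\mu_i\le\lambda_i$ for all $i$, and "the largest D-partition contained in $\lambda$" is the D-partition $\Delta\subseteq\lambda$ of maximal size. The shifted diagram of a strict partition $\lambda$ has, for each $i$, a row $i$ consisting of the boxes $(i,j)$ with $i\le j\le i+\lambda_i-1$; rows are drawn in French convention (row 1 at the bottom), so the box above $(i,j)$ is $(i+1,j)$ and the box to the right of $(i,j)$ is $(i,j+1)$. The main diagonal consists of the boxes $(i,i)$. Let $\mathbb{S}$ be the totally ordered alphabet $1'<1<2'<2<3'<3<\cdots$. A $P$-shifted set-valued tableau of shape $\lambda$ is an assignment $T$ of a nonempty finite subset $T(\mathsf{B})\subseteq\mathbb{S}$ to each box $\mathsf{B}$ of the shifted diagram such that for every box $\mathsf{B}$, writing $\mathsf{B}^\uparrow,\mathsf{B}^\rightarrow$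 for the boxes above and to the right (conditions imposed only when these boxes exist): if $\max T(\mathsf{B})$ is primed then $\max T(\mathsf{B})\le\min T(\mathsf{B}^\uparrow)$ and $\max T(\mathsf{B})<\min T(\mathsf{B}^\rightarrow)$; if $\max T(\mathsf{B})$ is unprimed then $\max T(\mathsf{B})<\min T(\mathsf{B}^\uparrow)$ and $\max T(\mathsf{B})\le\min T(\mathsf{B}^\rightarrow)$; and no box on the main diagonal contains a primed entry. $\mathrm{PSVT}(\lambda,n)$ denotes the set of such tableaux with all entries in $\{1',1,\dots,n',n\}$. The content $c(T)=(c_1,c_2,\dots)$ has $c_i$ equal to the number of entries of $T$ (over all boxes) equal to $i$ or $i'$; the degree is $d(T)=\sum_i c_i$. The $P$-Grothendieck polynomial is $GP_{\lambda,n}=\sum_{T\in\mathrm{PSVT}(\lambda,n)}\beta^{d(T)-|\lambda|}\mathbf{x}^{c(T)}$, where $\beta$ is a fixed nonzero scalar (e.g. $\beta=-1$) and $\mathbf{x}^{c}=\prod_i x_i^{c_i}$.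
   Formalization: The formal theorem assumes n ≥ ℓ(λ); for n < ℓ(λ) there are no tableaux, GP_{λ,n} = 0 has no degree, and the formula fails (λ=(2,1), n=1 would give 2). The scalar β is any nonzero element of an integral domain of characteristic 0. *)

theory Defs
  imports "HOL-Library.Poly_Mapping"
begin

section \<open>Partitions\<close>

text \<open>A partition is the list of its positive parts; \<open>part mu i\<close> is the \<open>i\<close>-th part, counted
  from \<open>i = 1\<close> and padded with zeros beyond the length.\<close>

definition is_partition :: "nat list \<Rightarrow> bool" where
  "is_partition mu \<longleftrightarrow> sorted_wrt (\<ge>) mu \<and> (\<forall>p \<in> set mu. 0 < p)"

definition strict_partition :: "nat list \<Rightarrow> bool" where
  "strict_partition mu \<longleftrightarrow> sorted_wrt (>) mu \<and> (\<forall>p \<in> set mu. 0 < p)"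

definition part :: "nat list \<Rightarrow> nat \<Rightarrow> nat" where
  "part mu i = (if 1 \<le> i \<and> i \<le> length mu then mu ! (i - 1) else 0)"

definition D_partition :: "nat list \<Rightarrow> bool" where
  "D_partition mu \<longleftrightarrow> is_partition mu \<and>
     (\<forall>i. 2 \<le> i \<and> i \<le> length mu \<longrightarrow> part mu i + 2 \<le> part mu (i - 1))"

definition contained_in :: "nat list \<Rightarrow> nat list \<Rightarrow> bool" where
  "contained_in mu lam \<longleftrightarrow> (\<forall>i\<ge>1. part mu i \<le> part lam i)"

definition largest_D_partition_in :: "nat list \<Rightarrow> nat list \<Rightarrow> bool" where
  "largest_D_partition_in lam \<Delta> \<longleftrightarrow>
     D_partition \<Delta> \<and> contained_in \<Delta> lam \<and>
     (\<forall>mu. D_partition mu \<and> contained_in mu lam \<longrightarrow> sum_list mu \<le> sum_list \<Delta>)"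

section \<open>The alphabet \<open>1' < 1 < 2' < 2 < \<dots>\<close>\<close>

text \<open>The type also contains the letters \<open>Primed 0\<close> and \<open>Unprimed 0\<close>, which are not in the alphabet;
  they are excluded from tableaux below.\<close>

datatype letter = Primed (idx: nat) | Unprimed (idx: nat)

fun is_primed :: "letter \<Rightarrow> bool" where
  "is_primed (Primed i) = True"
| "is_primed (Unprimed i) = False"

fun letter_rank :: "letter \<Rightarrow> nat" where
  "letter_rank (Primed i) = 2 * i"
| "letter_rank (Unprimed i) = 2 * i + 1"

lemma letter_rank_inject: "letter_rank a = letter_rank b \<longleftrightarrow> a = b"
  by (cases a; cases b) (simp_all, presburger+)

instantiation letter :: linorder
begin

definition less_eq_letter :: "letter \<Rightarrow> letter \<Rightarrow> bool" where
  "a \<le> b \<longleftrightarrow> letter_rank a \<le> letter_rank b"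

definition less_letter :: "letter \<Rightarrow> letter \<Rightarrow> bool" where
  "a < b \<longleftrightarrow> letter_rank a < letter_rank b"

instance
  by standard (auto simp: less_eq_letter_def less_letter_def letter_rank_inject[symmetric])

end

section \<open>Shifted set-valued tableaux\<close>

text \<open>A box is a pair (row, column), both counted from 1, with row 1 at the bottom.\<close>

type_synonym box = "nat \<times> nat"

definition shifted_diagram :: "nat list \<Rightarrow> box set" where
  "shifted_diagram lam =
     {(i, j). 1 \<le> i \<and> i \<le> length lam \<and> i \<le> j \<and> j \<le> i + part lam i - 1}"

fun box_above :: "box \<Rightarrow> box" where
  "box_above (i, j) = (i + 1, j)"

fun box_right :: "box \<Rightarrow> box" where
  "box_right (i, j) = (i, j + 1)"

text \<open>A tableau is a total function on boxes; it is normalised to be empty outside the diagram, so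
  that distinct functions are distinct tableaux.\<close>

definition P_shifted_svt :: "nat list \<Rightarrow> (box \<Rightarrow> letter set) \<Rightarrow> bool" where
  "P_shifted_svt lam T \<longleftrightarrow>
     (\<forall>b. b \<notin> shifted_diagram lam \<longrightarrow> T b = {}) \<and>
     (\<forall>b \<in> shifted_diagram lam.
        T b \<noteq> {} \<and> finite (T b) \<and> (\<forall>a \<in> T b. 1 \<le> idx a) \<and>
        (is_primed (Max (T b)) \<longrightarrow>
           (box_above b \<in> shifted_diagram lam \<longrightarrow> Max (T b) \<le> Min (T (box_above b))) \<and>
           (box_right b \<in> shifted_diagram lam \<longrightarrow> Max (T b) < Min (T (box_right b)))) \<and>
        (\<not> is_primed (Max (T b)) \<longrightarrow>
           (box_above b \<in> shifted_diagram lam \<longrightarrow> Max (T b) < Min (T (box_above b))) \<and>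
           (box_right b \<in> shifted_diagram lam \<longrightarrow> Max (T b) \<le> Min (T (box_right b))))) \<and>
     (\<forall>i. (i, i) \<in> shifted_diagram lam \<longrightarrow> (\<forall>a \<in> T (i, i). \<not> is_primed a))"

definition PSVT :: "nat list \<Rightarrow> nat \<Rightarrow> (box \<Rightarrow> letter set) set" where
  "PSVT lam n =
     {T. P_shifted_svt lam T \<and> (\<forall>b \<in> shifted_diagram lam. \<forall>a \<in> T b. idx a \<le> n)}"

definition tableau_content :: "(box \<Rightarrow> letter set) \<Rightarrow> nat \<Rightarrow> nat" where
  "tableau_content T i = card {(b, a). a \<in> T b \<and> idx a = i}"

definition tableau_degree :: "(box \<Rightarrow> letter set) \<Rightarrow> nat" where
  "tableau_degree T = Sum_any (tableau_content T)"

section \<open>Polynomials and the P-Grothendieck polynomial\<close>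

text \<open>Polynomials in the variables \<open>x\<^sub>0, x\<^sub>1, x\<^sub>2, \<dots>\<close> are finitely supported maps from exponent
  vectors to coefficients.\<close>

type_synonym 'a mpoly = "(nat \<Rightarrow>\<^sub>0 nat) \<Rightarrow>\<^sub>0 'a"

definition mconst :: "'a::comm_ring_1 \<Rightarrow> 'a mpoly" where
  "mconst c = Poly_Mapping.single 0 c"

definition mvar :: "nat \<Rightarrow> 'a::comm_ring_1 mpoly" where
  "mvar i = Poly_Mapping.single (Poly_Mapping.single i 1) 1"

definition monomial_degree :: "(nat \<Rightarrow>\<^sub>0 nat) \<Rightarrow> nat" where
  "monomial_degree m = (\<Sum>i \<in> Poly_Mapping.keys m. Poly_Mapping.lookup m i)"

text \<open>The total degree; the zero polynomial gets the value 0 by convention.\<close>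

definition mdegree :: "'a::comm_ring_1 mpoly \<Rightarrow> nat" where
  "mdegree p = Max (insert 0 (monomial_degree ` Poly_Mapping.keys p))"

definition GP :: "'a::comm_ring_1 \<Rightarrow> nat list \<Rightarrow> nat \<Rightarrow> 'a mpoly" where
  "GP \<beta> lam n =
     (\<Sum>T \<in> PSVT lam n.
        mconst (\<beta> ^ (tableau_degree T - sum_list lam)) * Prod_any (\<lambda>i. mvar i ^ tableau_content T i))"

end

theory Submission
  imports Defs
begin

text \<open>
  In characteristic zero no cancellation occurs, so the degree is the maximal number of entries of a
  tableau. Let \<open>f k\<close> be the column in which row \<open>k\<close> of the shifted diagram of \<open>\<Delta>\<close> ends. Maximality
  of \<open>\<Delta>\<close> forces the diagram of \<open>lam\<close> to be the disjoint union of the hooks that consist of row \<open>k\<close>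
  of \<open>\<Delta>\<close> and of the boxes above its last box \<open>(k, f k)\<close>. An unprimed letter can be repeated within
  a hook only along horizontal steps, and two adjacent boxes of a row share at most one letter. A
  primed \<open>i'\<close> occurs at most once per row; if its highest occurrence is in a row \<open>r\<close> above those
  rows of \<open>\<Delta>\<close> that have at least two boxes, then the hooks with \<open>f k \<le> r\<close> cannot contain the
  unprimed \<open>i\<close>, and this compensates exactly for the additional primed entries. Equality is attained
  by a tableau that peels off the outer rim of \<open>lam\<close> outside \<open>\<Delta>\<close>, one index at a time.
\<close>

section \<open>The degree as a maximum over tableaux\<close>

lemma finite_shifted_diagram: "finite (shifted_diagram lam)"
proof (rule finite_subset)
  show "shifted_diagram lam \<subseteq> (SIGMA i:{..length lam}. {..i + part lam i})"
    unfolding shifted_diagram_def by auto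
qed simp

lemma finite_letters: "finite {a :: letter. idx a \<le> n}"
proof (rule finite_subset)
  show "{a :: letter. idx a \<le> n} \<subseteq> Primed ` {..n} \<union> Unprimed ` {..n}"
  proof
    fix a :: letter
    assume "a \<in> {a. idx a \<le> n}"
    then show "a \<in> Primed ` {..n} \<union> Unprimed ` {..n}" by (cases a) auto
  qed
qed simp

lemma finite_PSVT: "finite (PSVT lam n)"
proof (rule finite_subset)
  show "PSVT lam n \<subseteq> {T. \<forall>b. (b \<in> shifted_diagram lam \<longrightarrow> T b \<in> Pow {a. idx a \<le> n}) \<and>
      (b \<notin> shifted_diagram lam \<longrightarrow> T b = {})}"
    unfolding PSVT_def P_shifted_svt_def by blast
  show "finite \<dots>"
    by (rule finite_set_of_finite_funs) (simp_all add: finite_shifted_diagram finite_letters)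
qed

lemma PSVT_memD:
  assumes "T \<in> PSVT lam n" "a \<in> T b"
  shows "b \<in> shifted_diagram lam" "1 \<le> idx a" "idx a \<le> n"
proof -
  show "b \<in> shifted_diagram lam"
    using assms unfolding PSVT_def P_shifted_svt_def by blast
  then show "1 \<le> idx a" "idx a \<le> n"
    using assms unfolding PSVT_def P_shifted_svt_def by blast+
qed

lemma PSVT_finite_boxes:
  assumes "T \<in> PSVT lam n"
  shows "finite {b. a \<in> T b}"
  by (rule finite_subset[OF _ finite_shifted_diagram[of lam]]) (use PSVT_memD(1)[OF assms] in auto)

lemma tableau_content_split:
  assumes "T \<in> PSVT lam n"
  shows "tableau_content T i = card {b. Primed i \<in> T b} + card {b. Unprimed i \<in> T b}"
proof -
  let ?A = "{b. Primed i \<in> T b}" and ?B = "{b. Unprimed i \<in> T b}"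
  have "{(b, a). a \<in> T b \<and> idx a = i} = (\<lambda>b. (b, Primed i)) ` ?A \<union> (\<lambda>b. (b, Unprimed i)) ` ?B"
  proof (intro equalityI subsetI)
    fix z assume "z \<in> {(b, a). a \<in> T b \<and> idx a = i}"
    then obtain b a where "z = (b, a)" "a \<in> T b" "idx a = i" by blast
    then show "z \<in> (\<lambda>b. (b, Primed i)) ` ?A \<union> (\<lambda>b. (b, Unprimed i)) ` ?B"
      by (cases a) auto
  qed auto
  moreover have "card \<dots> = card ((\<lambda>b. (b, Primed i)) ` ?A) + card ((\<lambda>b. (b, Unprimed i)) ` ?B)"
    by (rule card_Un_disjoint) (auto simp: PSVT_finite_boxes[OF assms])
  moreover have "card ((\<lambda>b. (b, Primed i)) ` ?A) = card ?A"
    by (rule card_image) (auto simp: inj_on_def)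
  moreover have "card ((\<lambda>b. (b, Unprimed i)) ` ?B) = card ?B"
    by (rule card_image) (auto simp: inj_on_def)
  ultimately show ?thesis unfolding tableau_content_def by simp
qed

lemma tableau_content_nonzeroD:
  assumes "T \<in> PSVT lam n" "tableau_content T i \<noteq> 0"
  shows "i \<in> {1..n}"
proof -
  have "{(b, a). a \<in> T b \<and> idx a = i} \<noteq> {}"
    using assms(2) unfolding tableau_content_def by (metis card.empty)
  then show ?thesis using PSVT_memD[OF assms(1)] by fastforce
qed

lemma tableau_degree_eq:
  assumes "T \<in> PSVT lam n"
  shows "tableau_degree T = (\<Sum>i=1..n. tableau_content T i)"
  unfolding tableau_degree_def
  by (rule Sum_any.expand_superset) (use tableau_content_nonzeroD[OF assms] in auto)

section \<open>Exponent vectors of tableaux and the support of \<open>GP\<close>\<close>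

definition content_exponent :: "nat \<Rightarrow> (box \<Rightarrow> letter set) \<Rightarrow> nat \<Rightarrow>\<^sub>0 nat" where
  "content_exponent n T = (\<Sum>i=1..n. Poly_Mapping.single i (tableau_content T i))"

lemma lookup_content_exponent:
  assumes "T \<in> PSVT lam n"
  shows "Poly_Mapping.lookup (content_exponent n T) i = tableau_content T i"
proof -
  have "Poly_Mapping.lookup (content_exponent n T) i =
      (\<Sum>j=1..n. if j = i then tableau_content T j else 0)"
    unfolding content_exponent_def by (simp add: lookup_sum lookup_single when_def)
  also have "\<dots> = tableau_content T i"
    using tableau_content_nonzeroD[OF assms, of i] by auto
  finally show ?thesis .
qed

lemma monomial_degree_content_exponent:
  assumes "T \<in> PSVT lam n"
  shows "monomial_degree (content_exponent n T) = tableau_degree T"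
  unfolding monomial_degree_def tableau_degree_eq[OF assms]
proof (rule sum.mono_neutral_cong_left)
  show "Poly_Mapping.keys (content_exponent n T) \<subseteq> {1..n}"
  proof
    fix i assume "i \<in> Poly_Mapping.keys (content_exponent n T)"
    then have "tableau_content T i \<noteq> 0"
      by (simp add: in_keys_iff lookup_content_exponent[OF assms])
    then show "i \<in> {1..n}" by (rule tableau_content_nonzeroD[OF assms])
  qed
qed (simp_all add: in_keys_iff lookup_content_exponent[OF assms])

lemma mvar_power: "mvar i ^ k = (Poly_Mapping.single (Poly_Mapping.single i k) 1 :: 'a::comm_ring_1 mpoly)"
proof (induction k)
  case (Suc k)
  then show ?case by (simp add: mvar_def mult_single flip: single_add)
qed simp

lemma prod_mvar_power:
  "(\<Prod>i\<in>A. mvar i ^ g i) =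
    (Poly_Mapping.single (\<Sum>i\<in>A. Poly_Mapping.single i (g i)) 1 :: 'a::comm_ring_1 mpoly)"
  by (induction A rule: infinite_finite_induct) (simp_all add: mvar_power mult_single)

lemma GP_term_eq:
  assumes "T \<in> PSVT lam n"
  shows "mconst c * Prod_any (\<lambda>i. mvar i ^ tableau_content T i) =
    (Poly_Mapping.single (content_exponent n T) c :: 'a::comm_ring_1 mpoly)"
proof -
  have "Prod_any (\<lambda>i. mvar i ^ tableau_content T i :: 'a mpoly) =
      (\<Prod>i=1..n. mvar i ^ tableau_content T i)"
  proof (rule Prod_any.expand_superset)
    show "{i. (mvar i ^ tableau_content T i :: 'a mpoly) \<noteq> 1} \<subseteq> {1..n}"
      using tableau_content_nonzeroD[OF assms] by (metis (mono_tags) mem_Collect_eq power_0 subsetI)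
  qed simp
  then show ?thesis
    by (simp add: prod_mvar_power mconst_def mult_single content_exponent_def)
qed

text \<open>Tableaux of equal content have equal degree, so the terms of one monomial carry the same power
  of \<open>\<beta>\<close> and cannot cancel in characteristic zero.\<close>

lemma keys_GP:
  fixes \<beta> :: "'a::{idom, ring_char_0}"
  assumes "\<beta> \<noteq> 0"
  shows "Poly_Mapping.keys (GP \<beta> lam n) = content_exponent n ` PSVT lam n"
proof -
  let ?c = "content_exponent n"
  have "Poly_Mapping.lookup (GP \<beta> lam n) m =
      of_nat (card {T \<in> PSVT lam n. ?c T = m}) * \<beta> ^ (monomial_degree m - sum_list lam)" for m
  proof -
    have "GP \<beta> lam n = (\<Sum>T\<in>PSVT lam n. Poly_Mapping.single (?c T) (\<beta> ^ (tableau_degree T - sum_list lam)))"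
      unfolding GP_def by (rule sum.cong) (simp_all add: GP_term_eq)
    then have "Poly_Mapping.lookup (GP \<beta> lam n) m =
        (\<Sum>T\<in>PSVT lam n. if ?c T = m then \<beta> ^ (tableau_degree T - sum_list lam) else 0)"
      by (simp add: lookup_sum lookup_single when_def)
    also have "\<dots> = (\<Sum>T\<in>{T \<in> PSVT lam n. ?c T = m}. \<beta> ^ (tableau_degree T - sum_list lam))"
      by (simp add: sum.inter_filter finite_PSVT)
    also have "\<dots> = (\<Sum>T\<in>{T \<in> PSVT lam n. ?c T = m}. \<beta> ^ (monomial_degree m - sum_list lam))"
      by (rule sum.cong) (auto simp: monomial_degree_content_exponent)
    finally show ?thesis by simp
  qed
  moreover have "card {T \<in> PSVT lam n. ?c T = m} = 0 \<longleftrightarrow> m \<notin> ?c ` PSVT lam n" for m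
    by (auto simp: finite_PSVT)
  ultimately show ?thesis using assms by (auto simp: in_keys_iff)
qed

lemma mdegree_GP_eqI:
  fixes \<beta> :: "'a::{idom, ring_char_0}"
  assumes "\<beta> \<noteq> 0"
    and "\<And>T. T \<in> PSVT lam n \<Longrightarrow> tableau_degree T \<le> G"
    and "T \<in> PSVT lam n" "G \<le> tableau_degree T"
  shows "mdegree (GP \<beta> lam n) = G"
proof -
  have "monomial_degree ` Poly_Mapping.keys (GP \<beta> lam n) = tableau_degree ` PSVT lam n"
    unfolding keys_GP[OF assms(1)] image_image
    by (rule image_cong) (simp_all add: monomial_degree_content_exponent)
  moreover have "tableau_degree T = G" using assms(2)[OF assms(3)] assms(4) by (rule le_antisym)
  ultimately have "G \<in> insert 0 (monomial_degree ` Poly_Mapping.keys (GP \<beta> lam n))"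
    and "\<And>d. d \<in> insert 0 (monomial_degree ` Poly_Mapping.keys (GP \<beta> lam n)) \<Longrightarrow> d \<le> G"
    using assms(2,3) by auto
  then show ?thesis unfolding mdegree_def by (intro Max_eqI) simp_all
qed

section \<open>Order relations between the entries of a tableau\<close>

lemma letter_less_simps [simp]:
  "Primed i \<le> Primed j \<longleftrightarrow> i \<le> j" "Unprimed i \<le> Unprimed j \<longleftrightarrow> i \<le> j"
  "Primed i \<le> Unprimed j \<longleftrightarrow> i \<le> j" "Unprimed i \<le> Primed j \<longleftrightarrow> i < j"
  by (auto simp: less_eq_letter_def)

lemma shifted_diagram_iff:
  "(r, c) \<in> shifted_diagram lam \<longleftrightarrow> 1 \<le> r \<and> r \<le> length lam \<and> r \<le> c \<and> c \<le> r + part lam r - 1"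
  by (simp add: shifted_diagram_def)

lemma strict_partition_part_less:
  assumes "strict_partition lam" "1 \<le> i" "i < j" "j \<le> length lam"
  shows "part lam j < part lam i"
  using assms unfolding strict_partition_def part_def
  by (auto dest: sorted_wrt_nth_less[of _ _ "i - 1" "j - 1"])

lemma strict_partition_part_pos:
  assumes "strict_partition lam" "1 \<le> i" "i \<le> length lam"
  shows "0 < part lam i"
  using assms unfolding strict_partition_def part_def by (auto simp: nth_mem)

text \<open>Each row starts one column further right than the row below and is at least one box
  shorter. Hence the columns of the diagram have no gaps.\<close>

lemma shifted_row_end_antimono:
  assumes "strict_partition lam" "1 \<le> i" "i \<le> j" "j \<le> length lam"
  shows "j + part lam j - 1 \<le> i + part lam i - 1"
  using assms(3,4)
proof (induction j rule: dec_induct)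
  case (step j)
  then show ?case
    using strict_partition_part_less[OF assms(1), of j "Suc j"] assms(2) by simp
qed simp

lemma shifted_diagram_below:
  assumes "strict_partition lam" "(r', c) \<in> shifted_diagram lam" "1 \<le> r" "r \<le> r'"
  shows "(r, c) \<in> shifted_diagram lam"
  using assms shifted_row_end_antimono[OF assms(1,3,4)] by (auto simp: shifted_diagram_iff)

lemmas PSVT_box_conditions =
  bspec[OF conjunct1[OF conjunct2[OF conjunct1[OF
    CollectD[OF PSVT_def[THEN equalityD1, THEN subsetD], unfolded P_shifted_svt_def]]]]]

lemma PSVT_nonempty:
  assumes "T \<in> PSVT lam n" "b \<in> shifted_diagram lam"
  shows "T b \<noteq> {}"
  using assms unfolding PSVT_def P_shifted_svt_def by blast

lemma PSVT_finite:
  assumes "T \<in> PSVT lam n" "b \<in> shifted_diagram lam"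
  shows "finite (T b)"
  using assms unfolding PSVT_def P_shifted_svt_def by blast

lemma PSVT_diagonal:
  assumes "T \<in> PSVT lam n" "a \<in> T (r, r)"
  shows "\<not> is_primed a"
  using assms PSVT_memD(1)[OF assms] unfolding PSVT_def P_shifted_svt_def by blast

text \<open>The definition compares the maximum of one box with the minimum of the next. If
  \<open>a = b\<close>, then \<open>a\<close> is squeezed into being that maximum, so the condition
  for its kind of letter applies; \<open>PSVT_up\<close> works in the same way.\<close>

lemma PSVT_right:
  assumes T: "T \<in> PSVT lam n" and ab: "a \<in> T (r, c)" "b \<in> T (r, Suc c)"
  shows "a \<le> b \<and> (a = b \<longrightarrow> \<not> is_primed a)"
proof -
  have d: "(r, c) \<in> shifted_diagram lam" "(r, Suc c) \<in> shifted_diagram lam"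
    using PSVT_memD(1)[OF T] ab by auto
  have m: "a \<le> Max (T (r, c))" "Min (T (r, Suc c)) \<le> b"
    using PSVT_finite[OF T] d ab by auto
  have "(is_primed (Max (T (r, c))) \<longrightarrow> Max (T (r, c)) < Min (T (r, Suc c))) \<and>
      (\<not> is_primed (Max (T (r, c))) \<longrightarrow> Max (T (r, c)) \<le> Min (T (r, Suc c)))"
    using PSVT_box_conditions[OF T d(1)] d(2) by (simp del: Max_le_iff Max_less_iff)
  then show ?thesis
    using m by (cases "is_primed (Max (T (r, c)))"; cases "a = Max (T (r, c))") auto
qed

lemma PSVT_up:
  assumes T: "T \<in> PSVT lam n" and ab: "a \<in> T (r, c)" "b \<in> T (Suc r, c)"
  shows "a \<le> b \<and> (a = b \<longrightarrow> is_primed a)"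
proof -
  have d: "(r, c) \<in> shifted_diagram lam" "(Suc r, c) \<in> shifted_diagram lam"
    using PSVT_memD(1)[OF T] ab by auto
  have m: "a \<le> Max (T (r, c))" "Min (T (Suc r, c)) \<le> b"
    using PSVT_finite[OF T] d ab by auto
  have "(is_primed (Max (T (r, c))) \<longrightarrow> Max (T (r, c)) \<le> Min (T (Suc r, c))) \<and>
      (\<not> is_primed (Max (T (r, c))) \<longrightarrow> Max (T (r, c)) < Min (T (Suc r, c)))"
    using PSVT_box_conditions[OF T d(1)] d(2) by (simp del: Max_le_iff Max_less_iff)
  then show ?thesis
    using m by (cases "is_primed (Max (T (r, c)))"; cases "a = Max (T (r, c))") auto
qed

lemma PSVT_row:
  assumes T: "T \<in> PSVT lam n" and a: "a \<in> T (r, c)" and "c < c'" "b \<in> T (r, c')"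
  shows "a \<le> b \<and> (a = b \<longrightarrow> \<not> is_primed a)"
  using assms(3,4)
proof (induction c' arbitrary: b)
  case (Suc c')
  show ?case
  proof (cases "c = c'")
    case True
    then show ?thesis using PSVT_right[OF T] a Suc.prems by blast
  next
    case False
    then have "c < c'" using Suc.prems by simp
    moreover have "(r, c') \<in> shifted_diagram lam"
      using PSVT_memD(1)[OF T a] PSVT_memD(1)[OF T Suc.prems(2)] \<open>c < c'\<close>
      by (simp add: shifted_diagram_iff)
    then obtain z where z: "z \<in> T (r, c')" using PSVT_nonempty[OF T] by blast
    ultimately show ?thesis
      using Suc.IH[OF _ z] PSVT_right[OF T z Suc.prems(2)] by (cases "a = z") auto
  qed
qed simp

lemma PSVT_column:
  assumes lam: "strict_partition lam" and T: "T \<in> PSVT lam n"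
    and a: "a \<in> T (r, c)" and "r < r'" "b \<in> T (r', c)"
  shows "a \<le> b \<and> (a = b \<longrightarrow> is_primed a)"
  using assms(4,5)
proof (induction r' arbitrary: b)
  case (Suc r')
  show ?case
  proof (cases "r = r'")
    case True
    then show ?thesis using PSVT_up[OF T] a Suc.prems by blast
  next
    case False
    then have "r < r'" using Suc.prems by simp
    moreover have "(r', c) \<in> shifted_diagram lam"
      using shifted_diagram_below[OF lam PSVT_memD(1)[OF T Suc.prems(2)], of r'] \<open>r < r'\<close> by simp
    then obtain z where z: "z \<in> T (r', c)" using PSVT_nonempty[OF T] by blast
    ultimately show ?thesis
      using Suc.IH[OF _ z] PSVT_up[OF T z Suc.prems(2)] by (cases "a = z") auto
  qed
qed simp

text \<open>Go right along row \<open>r\<close>, then up column \<open>c'\<close>. The corner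
  \<open>(r, c')\<close> lies in the diagram because \<open>(r', c')\<close> does, whereas
  \<open>(r', c)\<close> may lie left of the diagonal. A horizontal part rules out equal primed
  letters, a vertical part equal unprimed ones.\<close>

lemma PSVT_mono:
  assumes lam: "strict_partition lam" and T: "T \<in> PSVT lam n"
    and a: "a \<in> T (r, c)" and b: "b \<in> T (r', c')" and le: "r \<le> r'" "c \<le> c'" "(r, c) \<noteq> (r', c')"
  shows "a \<le> b" "a = b \<Longrightarrow> is_primed a \<Longrightarrow> c = c'" "a = b \<Longrightarrow> \<not> is_primed a \<Longrightarrow> r = r'"
proof -
  have "1 \<le> r" using PSVT_memD(1)[OF T a] by (simp add: shifted_diagram_iff)
  then have "(r, c') \<in> shifted_diagram lam"
    using shifted_diagram_below[OF lam PSVT_memD(1)[OF T b]] le by simp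
  then obtain z where z: "z \<in> T (r, c')" using PSVT_nonempty[OF T] by blast
  have row: "c < c' \<Longrightarrow> a \<le> z \<and> (a = z \<longrightarrow> \<not> is_primed a)" using PSVT_row[OF T a _ z] by blast
  have col: "r < r' \<Longrightarrow> z \<le> b \<and> (z = b \<longrightarrow> is_primed z)"
    using PSVT_column[OF lam T z _ b] by blast
  have row': "r = r' \<Longrightarrow> a \<le> b \<and> (a = b \<longrightarrow> \<not> is_primed a)" using PSVT_row[OF T a, of c' b] b le by auto
  have col': "c = c' \<Longrightarrow> a \<le> b \<and> (a = b \<longrightarrow> is_primed a)"
    using PSVT_column[OF lam T a, of r' b] b le by auto
  show "a \<le> b" using row col row' col' le by (cases "r = r'"; cases "c = c'") auto
  show "c = c'" if "a = b" "is_primed a"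
  proof (rule ccontr)
    assume "c \<noteq> c'"
    then show False using row col row' that le by (cases "r = r'") auto
  qed
  show "r = r'" if "a = b" "\<not> is_primed a"
  proof (rule ccontr)
    assume "r \<noteq> r'"
    then show False using row col col' that le by (cases "c = c'") auto
  qed
qed

text \<open>Entries of consecutive diagonal boxes are unprimed and lie in different rows, so they
  differ and their indices strictly increase.\<close>

lemma PSVT_row_le_idx_diagonal:
  assumes lam: "strict_partition lam" and T: "T \<in> PSVT lam n" and a: "a \<in> T (r, r)"
  shows "r \<le> idx a"
  using a
proof (induction r arbitrary: a)
  case (Suc r)
  show ?case
  proof (cases "r = 0")
    case True
    then show ?thesis using PSVT_memD(2)[OF T Suc.prems] by simp
  next
    case False
    have d: "(Suc r, Suc r) \<in> shifted_diagram lam" by (rule PSVT_memD(1)[OF T Suc.prems])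
    have "(r, r) \<in> shifted_diagram lam"
      using shifted_diagram_below[OF lam d, of r] False by (simp add: shifted_diagram_iff)
    then obtain z where z: "z \<in> T (r, r)" using PSVT_nonempty[OF T] by blast
    have "\<not> is_primed z" "\<not> is_primed a" using PSVT_diagonal[OF T z] PSVT_diagonal[OF T Suc.prems] .
    moreover have "z \<le> a" by (rule PSVT_mono(1)[OF lam T z Suc.prems]) simp_all
    moreover have "z \<noteq> a"
    proof
      assume "z = a"
      have "r = Suc r"
        by (rule PSVT_mono(3)[OF lam T z Suc.prems]) (simp_all add: \<open>z = a\<close> \<open>\<not> is_primed a\<close>)
      then show False by simp
    qed
    ultimately have "idx z < idx a" by (cases z; cases a) auto
    then show ?thesis using Suc.IH[OF z] by simp
  qed
qed simp

lemma PSVT_row_le_idx: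
  assumes lam: "strict_partition lam" and T: "T \<in> PSVT lam n" and a: "a \<in> T (r, c)"
  shows "r \<le> idx a" "is_primed a \<Longrightarrow> r < idx a"
proof -
  have d: "(r, c) \<in> shifted_diagram lam" by (rule PSVT_memD(1)[OF T a])
  then have "(r, r) \<in> shifted_diagram lam" by (simp add: shifted_diagram_iff)
  then obtain z where z: "z \<in> T (r, r)" using PSVT_nonempty[OF T] by blast
  have r: "r \<le> idx z" "\<not> is_primed z"
    using PSVT_row_le_idx_diagonal[OF lam T z] PSVT_diagonal[OF T z] by simp_all
  have "r \<le> idx a \<and> (is_primed a \<longrightarrow> r < idx a)"
  proof (cases "r = c")
    case True
    then show ?thesis
      using PSVT_row_le_idx_diagonal[OF lam T, of a r] PSVT_diagonal[OF T, of a r] a by simp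
  next
    case False
    then have "z \<le> a" using PSVT_mono(1)[OF lam T z a] d by (simp add: shifted_diagram_iff)
    then show ?thesis using r by (cases z; cases a) auto
  qed
  then show "r \<le> idx a" "is_primed a \<Longrightarrow> r < idx a" by simp_all
qed

section \<open>Hooks\<close>

lemma part_list_update:
  assumes "1 \<le> k" "k \<le> length mu"
  shows "part (mu[k - 1 := x]) i = (if i = k then x else part mu i)"
proof -
  have "k - Suc 0 \<noteq> i - Suc 0" if "i \<noteq> k" "0 < i" using that assms by linarith
  then show ?thesis using assms unfolding part_def by (auto simp: nth_list_update)
qed

lemma part_append_one: "part (mu @ [x]) i = (if i = Suc (length mu) then x else part mu i)"
  unfolding part_def by (auto simp: nth_append)

lemma part_pos_iff: "(\<forall>x\<in>set mu. 0 < x) \<longleftrightarrow> (\<forall>i. 1 \<le> i \<and> i \<le> length mu \<longrightarrow> 0 < part mu i)"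
proof
  show "\<forall>x\<in>set mu. 0 < x \<Longrightarrow> \<forall>i. 1 \<le> i \<and> i \<le> length mu \<longrightarrow> 0 < part mu i"
    unfolding part_def by (auto simp: nth_mem)
next
  assume *: "\<forall>i. 1 \<le> i \<and> i \<le> length mu \<longrightarrow> 0 < part mu i"
  show "\<forall>x\<in>set mu. 0 < x"
  proof
    fix x assume "x \<in> set mu"
    then obtain j where "j < length mu" "mu ! j = x" by (auto simp: in_set_conv_nth)
    then show "0 < x" using *[rule_format, of "Suc j"] by (simp add: part_def)
  qed
qed

lemma D_partition_iff:
  "D_partition mu \<longleftrightarrow> (\<forall>i. 1 \<le> i \<and> i \<le> length mu \<longrightarrow> 0 < part mu i) \<and>
     (\<forall>i. 1 \<le> i \<and> i < length mu \<longrightarrow> part mu (Suc i) + 2 \<le> part mu i)"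
proof -
  have gap: "(\<forall>i. 2 \<le> i \<and> i \<le> length mu \<longrightarrow> part mu i + 2 \<le> part mu (i - 1)) \<longleftrightarrow>
      (\<forall>i. 1 \<le> i \<and> i < length mu \<longrightarrow> part mu (Suc i) + 2 \<le> part mu i)" (is "?L \<longleftrightarrow> ?R")
  proof
    assume ?L
    then show ?R by (metis One_nat_def Suc_1 Suc_leI Suc_le_mono diff_Suc_1)
  next
    assume R: ?R
    show ?L
    proof (intro allI impI)
      fix i assume "2 \<le> i \<and> i \<le> length mu"
      then show "part mu i + 2 \<le> part mu (i - 1)" using R[rule_format, of "i - 1"] by (cases i) auto
    qed
  qed
  have sorted: "sorted_wrt (\<ge>) mu" if R: "\<forall>i. 1 \<le> i \<and> i < length mu \<longrightarrow> part mu (Suc i) + 2 \<le> part mu i"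
  proof -
    have "mu ! Suc i \<le> mu ! i" if "Suc i < length mu" for i
      using R[rule_format, of "Suc i"] that by (simp add: part_def)
    then show ?thesis by (subst sorted_wrt_iff_nth_Suc_transp) (auto simp: transp_def)
  qed
  show ?thesis
    unfolding D_partition_def is_partition_def gap part_pos_iff using sorted by blast
qed

text \<open>The extremal tableau is built here from any D-partition contained in \<open>lam\<close>;
  maximality of \<Delta> enters in \<open>largest_D_pair\<close>, for the upper bound.\<close>

locale shifted_D_pair =
  fixes lam \<Delta> :: "nat list" and n :: nat
  assumes strict: "strict_partition lam"
    and D: "D_partition \<Delta>"
    and contained: "contained_in \<Delta> lam"
    and length_le: "length lam \<le> n"
begin

abbreviation "p \<equiv> length \<Delta>"
abbreviation "q \<equiv> length lam"

definition row_end :: "nat \<Rightarrow> nat" where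
  "row_end r = r + part lam r - 1"

definition hook_col :: "nat \<Rightarrow> nat" where
  "hook_col k = k + part \<Delta> k - 1"

text \<open>The number of rows of \<Delta> with at least two boxes, since only the last part of a
  D-partition can be 1. It carries the case distinction of the degree formula.\<close>

definition long_rows :: nat where
  "long_rows = (if \<Delta> \<noteq> [] \<and> last \<Delta> = 1 then p - 1 else p)"

lemma diagram_iff: "(r, c) \<in> shifted_diagram lam \<longleftrightarrow> 1 \<le> r \<and> r \<le> q \<and> r \<le> c \<and> c \<le> row_end r"
  by (simp add: shifted_diagram_iff row_end_def)

lemma row_end_ge: "1 \<le> r \<Longrightarrow> r \<le> q \<Longrightarrow> r \<le> row_end r"
  using strict_partition_part_pos[OF strict, of r] by (simp add: row_end_def)

lemma row_end_antimono: "1 \<le> r \<Longrightarrow> r \<le> r' \<Longrightarrow> r' \<le> q \<Longrightarrow> row_end r' \<le> row_end r"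
  unfolding row_end_def by (rule shifted_row_end_antimono[OF strict])

lemma part_\<Delta>_pos: "1 \<le> k \<Longrightarrow> k \<le> p \<Longrightarrow> 0 < part \<Delta> k"
  using D unfolding D_partition_iff by blast

lemma hook_col_ge: "1 \<le> k \<Longrightarrow> k \<le> p \<Longrightarrow> k \<le> hook_col k"
  using part_\<Delta>_pos[of k] by (simp add: hook_col_def)

text \<open>Rows are shifted by one, so a gap of two between parts is a gap of one between row ends.
  Distinct hooks thus have distinct columns.\<close>

lemma hook_col_Suc: "1 \<le> k \<Longrightarrow> k < p \<Longrightarrow> hook_col (Suc k) < hook_col k"
  using D part_\<Delta>_pos[of k] unfolding D_partition_iff hook_col_def by force

lemma hook_col_less:
  assumes "1 \<le> k" "k < k'" "k' \<le> p"
  shows "hook_col k' < hook_col k"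
  using assms(2,3)
proof (induction k')
  case (Suc k')
  then show ?case using hook_col_Suc[of k'] assms(1) by (cases "k = k'") auto
qed simp

lemma hook_col_inj: "inj_on hook_col {1..p}"
proof (rule inj_onI)
  fix k k' assume "k \<in> {1..p}" "k' \<in> {1..p}" "hook_col k = hook_col k'"
  then show "k = k'" using hook_col_less[of k k'] hook_col_less[of k' k] by fastforce
qed

lemma p_le_q: "p \<le> q"
proof (cases "p = 0")
  case False
  then have "1 \<le> p" by linarith
  then have "0 < part lam p"
    using contained[unfolded contained_in_def, rule_format, of p] part_\<Delta>_pos[of p] by auto
  then show ?thesis unfolding part_def by (auto split: if_splits)
qed simp

lemma hook_col_le_row_end: "1 \<le> k \<Longrightarrow> hook_col k \<le> row_end k"
  using contained unfolding contained_in_def hook_col_def row_end_def by (simp add: diff_le_mono)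

lemma long_rows_bounds: "long_rows \<le> p" "p \<le> Suc long_rows"
  unfolding long_rows_def by auto

lemma last_\<Delta>: "0 < p \<Longrightarrow> last \<Delta> = part \<Delta> p"
  by (auto simp: part_def last_conv_nth Suc_leI)

text \<open>For the last row, \<open>hook_col p\<close> is \<open>p\<close> if the last part is 1
  and larger otherwise; earlier rows end further right.\<close>

lemma long_rows_less_hook_col:
  assumes "1 \<le> k" "k \<le> p"
  shows "long_rows < hook_col k"
proof -
  have "long_rows < hook_col p"
    using last_\<Delta> part_\<Delta>_pos[of p] assms unfolding long_rows_def hook_col_def by (cases \<Delta>) auto
  then show ?thesis using hook_col_less[of k p] assms by (cases "k = p") auto
qed

lemma less_hook_col: "1 \<le> k \<Longrightarrow> k \<le> long_rows \<Longrightarrow> k < hook_col k"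
  using long_rows_less_hook_col[of k] long_rows_bounds by simp

lemma sum_list_\<Delta>: "(\<Sum>k=1..p. Suc (hook_col k) - k) = sum_list \<Delta>"
proof -
  have "(\<Sum>k=1..p. Suc (hook_col k) - k) = (\<Sum>k=1..p. \<Delta> ! (k - 1))"
  proof (rule sum.cong)
    fix k assume "k \<in> {1..p}"
    then show "Suc (hook_col k) - k = \<Delta> ! (k - 1)"
      using part_\<Delta>_pos[of k] by (simp add: hook_col_def part_def)
  qed simp
  also have "\<dots> = (\<Sum>k<p. \<Delta> ! k)"
    by (rule sum.reindex_bij_witness[of _ Suc "\<lambda>k. k - 1"]) auto
  finally show ?thesis by (simp add: sum_list_sum_nth atLeast0LessThan)
qed

lemma sum_hook_col: "(\<Sum>k=1..p. hook_col k - k) + p = sum_list \<Delta>"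
proof -
  have "(\<Sum>k=1..p. Suc (hook_col k) - k) = (\<Sum>k=1..p. (hook_col k - k) + 1)"
    by (rule sum.cong) (auto simp: hook_col_ge Suc_diff_le)
  also have "\<dots> = (\<Sum>k=1..p. hook_col k - k) + p" by (subst sum.distrib) simp
  finally show ?thesis unfolding sum_list_\<Delta> ..
qed

end

section \<open>The upper bound\<close>

locale largest_D_pair = shifted_D_pair +
  assumes maximal: "D_partition mu \<Longrightarrow> contained_in mu lam \<Longrightarrow> sum_list mu \<le> sum_list \<Delta>"
begin

text \<open>Otherwise part \<open>k\<close> of \<Delta> could be enlarged by one, giving a larger
  D-partition inside \<open>lam\<close>.\<close>

lemma hook_col_greedy:
  assumes k: "1 \<le> k" "k \<le> p"
  shows "hook_col k = row_end k \<or> (1 < k \<and> hook_col (k - 1) = Suc (hook_col k))"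
proof (rule ccontr)
  assume not: "\<not> ?thesis"
  let ?mu = "\<Delta>[k - 1 := Suc (part \<Delta> k)]"
  have part_mu: "part ?mu i = (if i = k then Suc (part \<Delta> k) else part \<Delta> i)" for i
    by (rule part_list_update[OF k])
  have "part \<Delta> k < part lam k"
    using not hook_col_le_row_end[OF k(1)] k unfolding hook_col_def row_end_def by linarith
  then have "contained_in ?mu lam"
    using contained unfolding contained_in_def part_mu by auto
  moreover have "D_partition ?mu"
  proof -
    have gap: "part \<Delta> (Suc i) + 2 \<le> part \<Delta> i" if "1 \<le> i" "i < p" for i
      using D that unfolding D_partition_iff by blast
    \<comment> \<open>The row ends differ by at least two here, so the parts differ by at least
      three and still satisfy the gap condition after the enlargement.\<close>
    have "part \<Delta> k + 3 \<le> part \<Delta> (k - 1)" if "1 < k"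
      using not gap[of "k - 1"] that k part_\<Delta>_pos[OF k] unfolding hook_col_def by (cases k) auto
    then have "part ?mu (Suc i) + 2 \<le> part ?mu i" if "1 \<le> i" "i < p" for i
      unfolding part_mu using gap[OF that] that by auto
    moreover have "0 < part ?mu i" if "1 \<le> i" "i \<le> p" for i
      unfolding part_mu using part_\<Delta>_pos that by simp
    ultimately show ?thesis unfolding D_partition_iff by simp
  qed
  ultimately have "sum_list ?mu \<le> sum_list \<Delta>" by (rule maximal[rotated])
  moreover have "\<Delta> ! (k - 1) \<le> sum_list \<Delta>"
    using k by (intro member_le_sum_list) simp_all
  ultimately show False using k by (simp add: sum_list_update part_def)
qed

text \<open>If \<Delta> were empty or ended in a part of at least 3, a further part 1 could be
  appended inside \<open>lam\<close>.\<close>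

lemma part_last_le_2:
  assumes "p < q"
  shows "0 < p \<and> part \<Delta> p \<le> 2"
proof (rule ccontr)
  assume not: "\<not> ?thesis"
  have "0 < part lam (Suc p)" using strict_partition_part_pos[OF strict, of "Suc p"] assms by simp
  then have "contained_in (\<Delta> @ [1]) lam"
    using contained unfolding contained_in_def part_append_one by auto
  moreover have "D_partition (\<Delta> @ [1])"
    using D not unfolding D_partition_iff part_append_one by (auto simp: less_Suc_eq)
  ultimately show False using maximal[of "\<Delta> @ [1]"] by simp
qed

text \<open>Follow a column upwards. Above a box strictly left of the end of row \<open>r\<close> of
  \<Delta>, the next box of \<open>lam\<close> lies in row \<open>r + 1\<close> of \<Delta> by
  \<open>hook_col_greedy\<close>; above the last box of a row, the column is the leg of that
  hook.\<close>

lemma hooks_cover: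
  assumes "(r, c) \<in> shifted_diagram lam"
  shows "(r \<le> p \<and> c \<le> hook_col r) \<or> (\<exists>k\<in>{1..p}. k < r \<and> hook_col k = c)"
proof -
  have "1 \<le> r" using assms by (simp add: diagram_iff)
  then show ?thesis using assms
  proof (induction r rule: dec_induct)
    case base
    then have "0 < p" using part_last_le_2 by (cases "p < q") (auto simp: diagram_iff)
    then have "1 \<le> p" by linarith
    then show ?case using hook_col_greedy[of 1] base by (auto simp: diagram_iff)
  next
    case (step r)
    have "(r, c) \<in> shifted_diagram lam"
      using shifted_diagram_below[OF strict step.prems, of r] step.hyps by simp
    then consider "r \<le> p" "c < hook_col r" | "r \<le> p" "c = hook_col r" | "\<exists>k\<in>{1..p}. k < r \<and> hook_col k = c"
      using step.IH by force
    then show ?case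
    proof cases
      case 1
      \<comment> \<open>If \<open>r = p\<close>, the box above gives \<open>p < q\<close>, so the
        last part is at most 2. Then \<open>c < hook_col p \<le> p + 1\<close>, which puts that box
        left of the diagonal.\<close>
      have "r < p"
      proof (rule ccontr)
        assume "\<not> r < p"
        then have "r = p" "p < q" using 1 step.prems by (auto simp: diagram_iff)
        then have "hook_col r \<le> Suc p" using part_last_le_2 by (auto simp: hook_col_def)
        then show False using 1 \<open>r = p\<close> step.prems by (simp add: diagram_iff)
      qed
      then show ?thesis using hook_col_greedy[of "Suc r"] 1 step.prems by (auto simp: diagram_iff)
    next
      case 2
      then show ?thesis using step.hyps by (auto intro: bexI[of _ r])
    next
      case 3
      then show ?thesis using less_SucI by blast
    qed
  qed
qed

definition hook :: "box \<Rightarrow> nat" where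
  "hook b = (if fst b \<le> p \<and> snd b \<le> hook_col (fst b) then fst b
    else inv_into {1..p} hook_col (snd b))"

lemma hook_props:
  assumes "(r, c) \<in> shifted_diagram lam"
  shows "1 \<le> hook (r, c)" "hook (r, c) \<le> p" "hook (r, c) \<le> r" "c \<le> hook_col (hook (r, c))"
    "hook (r, c) < r \<Longrightarrow> c = hook_col (hook (r, c))"
proof -
  let ?k = "hook (r, c)"
  have "1 \<le> ?k \<and> ?k \<le> p \<and> ?k \<le> r \<and> c \<le> hook_col ?k \<and> (?k < r \<longrightarrow> c = hook_col ?k)"
  proof (cases "r \<le> p \<and> c \<le> hook_col r")
    case True
    then show ?thesis using assms by (simp add: hook_def diagram_iff)
  next
    case False
    then obtain k where k: "k \<in> {1..p}" "k < r" "hook_col k = c" using hooks_cover[OF assms] by blast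
    have "?k = inv_into {1..p} hook_col c" using False by (auto simp: hook_def)
    then have "?k = k" using inv_into_f_f[OF hook_col_inj k(1)] k(3) by simp
    then show ?thesis using k by simp
  qed
  then show "1 \<le> ?k" "?k \<le> p" "?k \<le> r" "c \<le> hook_col ?k" "?k < r \<Longrightarrow> c = hook_col ?k" by simp_all
qed

text \<open>The box in row \<open>long_rows + 1\<close> and column \<open>j\<close> lies in
  \<open>lam\<close>. That row of \<Delta> has at most its diagonal box, so the box is the end of a
  row of \<Delta> or lies above such an end.\<close>

lemma small_columns_are_hook_cols:
  assumes d: "(r, c) \<in> shifted_diagram lam" and j: "long_rows < j" "j \<le> r"
  shows "j \<in> hook_col ` {1..p}"
proof -
  have "(Suc long_rows, c) \<in> shifted_diagram lam"
    using shifted_diagram_below[OF strict d, of "Suc long_rows"] j by simp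
  then have "(Suc long_rows, j) \<in> shifted_diagram lam" using d j by (simp add: diagram_iff)
  from hooks_cover[OF this] show ?thesis
  proof
    assume *: "Suc long_rows \<le> p \<and> j \<le> hook_col (Suc long_rows)"
    then have "Suc long_rows = p" "last \<Delta> = 1" "0 < p" using long_rows_bounds unfolding long_rows_def by (auto split: if_splits)
    then have "hook_col (Suc long_rows) = Suc long_rows" using last_\<Delta> by (simp add: hook_col_def)
    then have "j = hook_col (Suc long_rows)" using * j by simp
    then show ?thesis using * by simp
  qed auto
qed

text \<open>The occurrences of \<open>i\<close> that are charged to horizontal steps of \<Delta>;
  each step is recorded by its right box.\<close>

definition repeats :: "(box \<Rightarrow> letter set) \<Rightarrow> nat \<Rightarrow> box set" where
  "repeats T i = {(r, c). 1 \<le> r \<and> r \<le> p \<and> r < c \<and> c \<le> hook_col r \<and>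
     Unprimed i \<in> T (r, c - 1) \<and> Unprimed i \<in> T (r, c)}"

lemma repeats_subset: "repeats T i \<subseteq> (SIGMA r:{1..p}. {r<..hook_col r})"
  unfolding repeats_def by auto

lemma finite_repeats: "finite (repeats T i)"
  by (rule finite_subset[OF repeats_subset]) simp

text \<open>Unprimed letters strictly increase upwards, so both occurrences share a row; a leg has
  one box per row, so this row is the arm of the hook. The left neighbour of the second box is then
  squeezed between two occurrences of \<open>i\<close>.\<close>

lemma repeatsI:
  assumes T: "T \<in> PSVT lam n" and i: "Unprimed i \<in> T (r, c)" "Unprimed i \<in> T (r', c')"
    and eq: "hook (r, c) = hook (r', c')" and le: "r < r' \<or> (r = r' \<and> c < c')"
  shows "(r', c') \<in> repeats T i"
proof -
  let ?k = "hook (r, c)"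
  have d: "(r, c) \<in> shifted_diagram lam" "(r', c') \<in> shifted_diagram lam"
    using PSVT_memD(1)[OF T] i by blast+
  note k = hook_props[OF d(1)] hook_props[OF d(2), folded eq]
  have "r = r'"
  proof (rule ccontr)
    assume "r \<noteq> r'"
    then have "r < r'" using le by simp
    then have "c' = hook_col ?k" using k by simp
    have "r = r'"
      by (rule PSVT_mono(3)[OF strict T i])
        (use \<open>r < r'\<close> \<open>c' = hook_col ?k\<close> k in simp_all)
    then show False using \<open>r \<noteq> r'\<close> by simp
  qed
  then have "c < c'" using le by simp
  have "?k = r"
  proof (rule ccontr)
    assume "?k \<noteq> r"
    then have "?k < r" using k(3) by simp
    then have "c = hook_col ?k" "c' = hook_col ?k" using k(5,10) \<open>r = r'\<close> by simp_all
    then show False using \<open>c < c'\<close> by simp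
  qed
  have "Unprimed i \<in> T (r, c' - 1)"
  proof (cases "c = c' - 1")
    case False
    then have between: "c < c' - 1" "c' - 1 < c'" using \<open>c < c'\<close> by simp_all
    then have "(r, c' - 1) \<in> shifted_diagram lam" using d \<open>r = r'\<close> by (auto simp: diagram_iff)
    then obtain z where z: "z \<in> T (r, c' - 1)" using PSVT_nonempty[OF T] by blast
    have "Unprimed i \<le> z" "z \<le> Unprimed i"
      using PSVT_row[OF T i(1) between(1) z] PSVT_row[OF T z between(2)] i(2) \<open>r = r'\<close> by blast+
    then show ?thesis using z by simp
  qed (use i in simp)
  then show ?thesis
    unfolding repeats_def using i k d \<open>r = r'\<close> \<open>?k = r\<close> \<open>c < c'\<close> by (simp add: diagram_iff)
qed

lemma inj_on_hook_non_repeats: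
  assumes T: "T \<in> PSVT lam n"
  shows "inj_on hook ({b. Unprimed i \<in> T b} - repeats T i)"
proof (rule inj_onI, rule ccontr)
  fix b b'
  assume b: "b \<in> {b. Unprimed i \<in> T b} - repeats T i" "b' \<in> {b. Unprimed i \<in> T b} - repeats T i"
    and eq: "hook b = hook b'" and "b \<noteq> b'"
  obtain r c r' c' where rc: "b = (r, c)" "b' = (r', c')" by fastforce
  consider "r < r' \<or> (r = r' \<and> c < c')" | "r' < r \<or> (r' = r \<and> c' < c)"
    using \<open>b \<noteq> b'\<close> rc by fastforce
  then show False
    using repeatsI[OF T, of i r c r' c'] repeatsI[OF T, of i r' c' r c] b eq rc by cases auto
qed

text \<open>Two adjacent boxes share at most one unprimed letter, so the sets of repeats are
  disjoint; the rows of \<Delta> have \<open>sum_list \<Delta> - p\<close> horizontal steps in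
  all.\<close>

lemma sum_card_repeats:
  assumes T: "T \<in> PSVT lam n"
  shows "(\<Sum>i\<in>I. card (repeats T i)) + p \<le> sum_list \<Delta>"
proof (cases "finite I")
  case True
  let ?S = "SIGMA r:{1..p}. {r<..hook_col r}"
  have "repeats T i \<inter> repeats T j = {}" if "i \<noteq> j" for i j
  proof (rule ccontr)
    assume "repeats T i \<inter> repeats T j \<noteq> {}"
    then obtain r c where c: "r < c"
      and i: "Unprimed i \<in> T (r, c - 1)" "Unprimed i \<in> T (r, c)"
      and j: "Unprimed j \<in> T (r, c - 1)" "Unprimed j \<in> T (r, c)"
      unfolding repeats_def by blast
    have "c - 1 < c" using c by simp
    then have "i \<le> j" "j \<le> i"
      using PSVT_row[OF T i(1) _ j(2)] PSVT_row[OF T j(1) _ i(2)] by simp_all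
    then show False using that by simp
  qed
  then have "(\<Sum>i\<in>I. card (repeats T i)) = card (\<Union>i\<in>I. repeats T i)"
    using True finite_repeats by (subst card_UN_disjoint) auto
  also have "\<dots> \<le> card ?S" using repeats_subset by (intro card_mono) auto
  also have "\<dots> = (\<Sum>k=1..p. hook_col k - k)" by simp
  finally show ?thesis using sum_hook_col by simp
qed (use sum_hook_col in simp)

lemma letter_bound:
  assumes T: "T \<in> PSVT lam n" and "1 \<le> i"
  shows "card {b. Primed i \<in> T b} + card ({b. Unprimed i \<in> T b} - repeats T i)
    \<le> min p i + min long_rows (i - 1)"
proof -
  let ?P = "{b. Primed i \<in> T b}" and ?U = "{b. Unprimed i \<in> T b} - repeats T i"
  have finP: "finite ?P" by (rule PSVT_finite_boxes[OF T])
  have injP: "inj_on fst ?P"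
  proof (rule inj_onI, clarsimp)
    fix r c c' assume a: "Primed i \<in> T (r, c)" "Primed i \<in> T (r, c')"
    show "c = c'"
    proof (rule ccontr)
      assume "c \<noteq> c'"
      then consider "c < c'" | "c' < c" by linarith
      then show False using PSVT_row[OF T a(1) _ a(2)] PSVT_row[OF T a(2) _ a(1)] by cases auto
    qed
  qed
  have rowP: "1 \<le> r \<and> r < i" if "r \<in> fst ` ?P" for r
    using that PSVT_row_le_idx(2)[OF strict T] PSVT_memD(1)[OF T]
    by (fastforce simp: diagram_iff)
  have cardP: "card ?P = card (fst ` ?P)" by (rule card_image[OF injP, symmetric])
  have cardU: "card ?U = card (hook ` ?U)"
    by (rule card_image[OF inj_on_hook_non_repeats[OF T], symmetric])
  have hookU: "1 \<le> k \<and> k \<le> p \<and> k \<le> i" if kU: "k \<in> hook ` ?U" for k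
  proof -
    obtain r c where rc: "k = hook (r, c)" "Unprimed i \<in> T (r, c)" using kU by auto
    show ?thesis
      using hook_props(1-3)[OF PSVT_memD(1)[OF T rc(2)]] PSVT_row_le_idx(1)[OF strict T rc(2)] rc(1)
      by simp
  qed
  have "hook ` ?U \<subseteq> {1..min p i}" using hookU by auto
  from card_mono[OF _ this] have U: "card ?U \<le> min p i" using cardU by simp
  have "fst ` ?P \<subseteq> {1..<i}" using rowP by (metis atLeastLessThan_iff subsetI)
  from card_mono[OF _ this] have P: "card ?P \<le> i - 1" using cardP by simp
  show ?thesis
  \<comment> \<open>Unless \<open>i'\<close> reaches a row above \<open>long_rows\<close>, the two
    cardinalities are bounded separately.\<close>
  proof (cases "i - 1 \<le> long_rows \<or> ?P = {} \<or> Max (fst ` ?P) \<le> long_rows")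
    case True
    have Max: "card ?P \<le> long_rows" if "Max (fst ` ?P) \<le> long_rows"
    proof -
      have "r \<in> {1..long_rows}" if "r \<in> fst ` ?P" for r
        using rowP[OF that] Max_ge[OF finite_imageI[OF finP] that] \<open>Max (fst ` ?P) \<le> long_rows\<close> by simp
      then have "fst ` ?P \<subseteq> {1..long_rows}" by blast
      from card_mono[OF _ this] show ?thesis using cardP by simp
    qed
    have empty: "card ?P \<le> long_rows" if "?P = {}" unfolding that by simp
    have "card ?P \<le> min long_rows (i - 1)" using True P Max empty by linarith
    then show ?thesis using U by linarith
  next
    case False
    define r where "r = Max (fst ` ?P)"
    have r: "r \<in> fst ` ?P" unfolding r_def using False finP by (intro Max_in) auto
    then obtain c where c: "Primed i \<in> T (r, c)" by auto
    have d: "(r, c) \<in> shifted_diagram lam" by (rule PSVT_memD(1)[OF T c])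
    have "r \<noteq> c" using PSVT_diagonal[OF T, of "Primed i" r] c by auto
    then have "r < c" using d by (simp add: diagram_iff)
    have "fst ` ?P \<subseteq> {1..r}"
      using rowP Max_ge[OF finite_imageI[OF finP]] unfolding r_def by (metis atLeastAtMost_iff subsetI)
    from card_mono[OF _ this] have "card ?P \<le> r" using cardP by simp
    \<comment> \<open>A box of such a hook has row \<le> column \<le> \<open>r\<close>, hence lies
      weakly below and left of the box \<open>(r, c)\<close> containing \<open>i'\<close>; it has no
      room for the larger letter \<open>i\<close>.\<close>
    let ?K = "{k \<in> {1..p}. hook_col k \<le> r}"
    have "hook ` ?U \<inter> ?K = {}"
    proof (rule ccontr)
      assume "hook ` ?U \<inter> ?K \<noteq> {}"
      then obtain r' c' where b: "Unprimed i \<in> T (r', c')" "hook_col (hook (r', c')) \<le> r" by auto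
      have d': "(r', c') \<in> shifted_diagram lam" by (rule PSVT_memD(1)[OF T b(1)])
      have "c' \<le> r" "r' \<le> r" using hook_props(4)[OF d'] b(2) d' by (auto simp: diagram_iff)
      then have "Unprimed i \<le> Primed i"
        by (intro PSVT_mono(1)[OF strict T b(1) c]) (use \<open>r < c\<close> in auto)
      then show False by simp
    qed
    then have "card (hook ` ?U) + card ?K = card (hook ` ?U \<union> ?K)"
      using PSVT_finite_boxes[OF T] by (intro card_Un_disjoint[symmetric]) auto
    also have "\<dots> \<le> card {1..p}" using hookU by (intro card_mono) auto
    finally have "card ?U + card ?K \<le> p" using cardU by simp
    moreover have "r - long_rows \<le> card ?K"
    proof -
      \<comment> \<open>At least \<open>r - long_rows\<close> hooks are lost to \<open>i\<close>,
        which pays for the rows above \<open>long_rows\<close> in which \<open>i'\<close> may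
        occur.\<close>
      have "{long_rows<..r} \<subseteq> hook_col ` ?K" using small_columns_are_hook_cols[OF d] by fastforce
      from surj_card_le[OF _ this] show ?thesis by simp
    qed
    moreover have "long_rows < r" using False r_def by simp
    ultimately have "card ?P + card ?U \<le> p + long_rows" using \<open>card ?P \<le> r\<close> by simp
    moreover have "p < i" "long_rows < i - 1" using False long_rows_bounds by linarith+
    ultimately show ?thesis by simp
  qed
qed

lemma tableau_degree_le:
  assumes T: "T \<in> PSVT lam n"
  shows "tableau_degree T + p \<le> sum_list \<Delta> + (\<Sum>i=1..n. min p i + min long_rows (i - 1))"
proof -
  have "tableau_degree T \<le> (\<Sum>i=1..n. (min p i + min long_rows (i - 1)) + card (repeats T i))"
    unfolding tableau_degree_eq[OF T]
  proof (rule sum_mono)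
    fix i assume "i \<in> {1..n}"
    then have "1 \<le> i" by simp
    have "card {b. Unprimed i \<in> T b} \<le> card ({b. Unprimed i \<in> T b} - repeats T i) + card (repeats T i)"
      using diff_card_le_card_Diff[of "repeats T i" "{b. Unprimed i \<in> T b}"] finite_repeats[of T i] by simp
    then show "tableau_content T i \<le> (min p i + min long_rows (i - 1)) + card (repeats T i)"
      using letter_bound[OF T \<open>1 \<le> i\<close>] tableau_content_split[OF T, of i] by simp
  qed
  also have "\<dots> = (\<Sum>i=1..n. min p i + min long_rows (i - 1)) + (\<Sum>i=1..n. card (repeats T i))"
    by (rule sum.distrib)
  finally show ?thesis using sum_card_repeats[OF T, of "{1..n}"] by simp
qed

end

section \<open>A tableau attaining the bound\<close>

context shifted_D_pair
begin

text \<open>The boxes of the extremal tableau that contain a letter of index at most \<open>i\<close> are those of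
  the first \<open>i\<close> rows of \<open>\<Delta>\<close> and those whose translate by \<open>n - i\<close> diagonal steps stays in the
  diagram of \<open>lam\<close>; \<open>shape_end i r\<close> is the last column of row \<open>r\<close> of this shape, or 0 if the row
  is empty. In passing from \<open>i - 1\<close> to \<open>i\<close> the shape grows by the outer rim outside \<open>\<Delta>\<close>, which is
  as large as a ribbon filled with \<open>i'\<close> and \<open>i\<close> can be.\<close>

definition shape_end :: "nat \<Rightarrow> nat \<Rightarrow> nat" where
  "shape_end i r = max (if r \<le> p \<and> r \<le> i then hook_col r else 0)
     (if r + (n - i) \<le> q then row_end (r + (n - i)) - (n - i) else 0)"

section \<open>Growth of the shapes\<close>

lemma shape_end_ge_hook_col: "r \<le> p \<Longrightarrow> r \<le> i \<Longrightarrow> hook_col r \<le> shape_end i r"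
  by (simp add: shape_end_def)

lemma shape_end_ge_shifted: "r + (n - i) \<le> q \<Longrightarrow> row_end (r + (n - i)) - (n - i) \<le> shape_end i r"
  by (simp add: shape_end_def)

lemma shape_end_ge_row:
  assumes "1 \<le> r" "r + (n - i) \<le> q"
  shows "r \<le> shape_end i r"
  using row_end_ge[of "r + (n - i)"] assms shape_end_ge_shifted[OF assms(2)] by linarith

lemma shape_end_pos_cases:
  assumes "0 < shape_end i r"
  obtains "r \<le> p" "r \<le> i" "shape_end i r = hook_col r"
  | "r + (n - i) \<le> q" "shape_end i r = row_end (r + (n - i)) - (n - i)"
  using assms unfolding shape_end_def by (auto simp: max_def split: if_splits)

lemma shape_end_pos_row_le:
  assumes "0 < shape_end i r" "i \<le> n"
  shows "r \<le> i"
  using assms(1) by (rule shape_end_pos_cases) (use assms(2) length_le in linarith)+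

lemma shape_end_Suc_row:
  assumes "1 \<le> r"
  shows "shape_end i (Suc r) \<le> shape_end i r"
proof (cases "0 < shape_end i (Suc r)")
  case True
  then show ?thesis
  proof (cases rule: shape_end_pos_cases)
    case 1
    then show ?thesis using hook_col_Suc[of r] shape_end_ge_hook_col[of r i] assms by simp
  next
    case 2
    have "row_end (Suc r + (n - i)) \<le> row_end (r + (n - i))"
      using 2 assms by (intro row_end_antimono) simp_all
    moreover have "row_end (r + (n - i)) - (n - i) \<le> shape_end i r"
      using 2 by (intro shape_end_ge_shifted) simp
    ultimately show ?thesis using 2 by linarith
  qed
qed simp

text \<open>Row \<open>r\<close> moved by \<open>n - (i - 1)\<close> steps and row
  \<open>r + 1\<close> moved by \<open>n - i\<close> steps reach the same row of \<open>lam\<close>,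
  but the second move back is one column shorter. So a row end not given by \<Delta> has a box of
  shape \<open>i\<close> diagonally above it to the right.\<close>

lemma shape_end_rim:
  assumes "1 \<le> r" "1 \<le> i" "i \<le> n" "0 < shape_end (i - 1) r"
  obtains "r \<le> p" "r < i" "shape_end (i - 1) r = hook_col r"
  | "shape_end (i - 1) r < shape_end i (Suc r)"
  using assms(4)
proof (cases rule: shape_end_pos_cases)
  case 1
  then show ?thesis using that(1) assms(2) by linarith
next
  case 2
  have eq: "r + (n - (i - 1)) = Suc r + (n - i)" using assms by simp
  have "Suc r + (n - i) \<le> row_end (Suc r + (n - i))"
    using 2 eq by (intro row_end_ge) simp_all
  moreover have "shape_end (i - 1) r = row_end (Suc r + (n - i)) - (n - (i - 1))"
    using 2(2) unfolding eq .
  ultimately have "shape_end (i - 1) r < row_end (Suc r + (n - i)) - (n - i)"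
    using assms by linarith
  also have "\<dots> \<le> shape_end i (Suc r)" using 2 eq by (intro shape_end_ge_shifted) simp
  finally show ?thesis by (rule that(2))
qed

lemma shape_end_pred:
  assumes "1 \<le> r" "1 \<le> i" "i \<le> n"
  shows "shape_end (i - 1) r \<le> shape_end i r"
proof (cases "0 < shape_end (i - 1) r")
  case True
  with assms show ?thesis
  proof (cases rule: shape_end_rim)
    case 1
    then show ?thesis using shape_end_ge_hook_col[of r i] by simp
  next
    case 2
    then show ?thesis using shape_end_Suc_row[of r i] assms by simp
  qed
qed simp

lemma shape_end_mono:
  assumes "1 \<le> r" "i \<le> j" "j \<le> n"
  shows "shape_end i r \<le> shape_end j r"
  using assms(2,3)
proof (induction j rule: dec_induct)
  case (step j)
  then show ?case using shape_end_pred[of r "Suc j"] assms(1) by simp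
qed simp

text \<open>The boxes added at step \<open>i\<close> contain no 2 by 2 square: a diagonal step down
  from shape \<open>i\<close> leads into shape \<open>i - 1\<close>.\<close>

lemma shape_end_diagonal:
  assumes "1 \<le> r" "1 \<le> i" "i \<le> n"
  shows "shape_end i (Suc r) \<le> Suc (shape_end (i - 1) r)"
proof (cases "0 < shape_end i (Suc r)")
  case True
  then show ?thesis
  proof (cases rule: shape_end_pos_cases)
    case 1
    then have "hook_col (Suc r) < hook_col r" "hook_col r \<le> shape_end (i - 1) r"
      using hook_col_Suc[of r] shape_end_ge_hook_col[of r "i - 1"] assms by simp_all
    then show ?thesis using 1 by simp
  next
    case 2
    have eq: "r + (n - (i - 1)) = Suc r + (n - i)" using assms by simp
    then have "row_end (Suc r + (n - i)) - (n - (i - 1)) \<le> shape_end (i - 1) r"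
      using shape_end_ge_shifted[of r "i - 1"] 2 by simp
    then show ?thesis using 2 assms by simp
  qed
qed simp

lemma shape_end_n:
  assumes "1 \<le> r"
  shows "shape_end n r = (if r \<le> q then row_end r else 0)"
  using assms hook_col_le_row_end[of r] p_le_q by (auto simp: shape_end_def max_def)

lemma shape_end_0: "1 \<le> r \<Longrightarrow> shape_end 0 r = 0"
  using length_le by (simp add: shape_end_def)

text \<open>The number of rows that receive \<open>i'\<close>: the rows among the first
  \<open>i - 1\<close> in which \<Delta> has at least two boxes, and the rows below a row of the
  translate of \<open>lam\<close>. At most one row of shape \<open>i\<close> lies above
  them.\<close>

definition primed_rows :: "nat \<Rightarrow> nat" where
  "primed_rows i = max (min long_rows (i - 1)) (i - 1 - (n - q))"

lemma primed_rows_le: "primed_rows i \<le> i - 1"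
  by (simp add: primed_rows_def)

lemma shape_end_pos_row_le_primed_rows:
  assumes "0 < shape_end i r" "i \<le> n"
  shows "r \<le> Suc (primed_rows i)"
  using assms(1)
proof (cases rule: shape_end_pos_cases)
  case 1
  then show ?thesis using long_rows_bounds unfolding primed_rows_def by auto
next
  case 2
  then show ?thesis using assms(2) length_le unfolding primed_rows_def by linarith
qed

text \<open>The column of \<open>i'\<close> in row \<open>r\<close> is that of the first box new in the shape of index \<open>i\<close>. If the
  last old box has nothing above it, \<open>i'\<close> moves there, so that this box can also take an \<open>i\<close>.\<close>

definition first_col :: "nat \<Rightarrow> nat \<Rightarrow> nat" where
  "first_col i r = (let u = shape_end (i - 1) r in
     if shape_end i (Suc r) < u \<or> shape_end i r \<le> u then u else Suc u)"

lemma first_col_bounds: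
  assumes "1 \<le> r" "1 \<le> i" "i \<le> n"
  shows "shape_end (i - 1) r \<le> first_col i r" "first_col i r \<le> Suc (shape_end (i - 1) r)"
    "first_col i r \<le> shape_end i r"
  using shape_end_pred[OF assms] by (auto simp: first_col_def Let_def)

text \<open>This keeps \<open>i'\<close> off the diagonal. A long row of \<Delta> passes the
  diagonal already in shape \<open>i - 1\<close>; in the other case \<open>(r, r)\<close> is old and
  \<open>(r, r + 1)\<close> lies in shape \<open>i\<close>.\<close>

lemma row_less_first_col:
  assumes "1 \<le> r" "r \<le> primed_rows i" "i \<le> n"
  shows "r < first_col i r"
proof -
  have i: "1 \<le> i" using assms primed_rows_le[of i] by linarith
  consider "r \<le> long_rows" "r < i" | "r \<le> i - 1 - (n - q)"
    using assms i unfolding primed_rows_def by fastforce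
  then show ?thesis
  proof cases
    case 1
    then have "hook_col r \<le> shape_end (i - 1) r"
      using long_rows_bounds by (intro shape_end_ge_hook_col) simp_all
    then show ?thesis using less_hook_col[of r] first_col_bounds(1)[of r i] 1 assms i by simp
  next
    case 2
    have "r + (n - (i - 1)) \<le> q" "Suc r + (n - i) \<le> q" using 2 assms i length_le by linarith+
    then have "r \<le> shape_end (i - 1) r" "Suc r \<le> shape_end i (Suc r)"
      using assms by (intro shape_end_ge_row; simp)+
    moreover have "shape_end i (Suc r) \<le> shape_end i r" using assms by (intro shape_end_Suc_row)
    ultimately show ?thesis by (auto simp: first_col_def Let_def)
  qed
qed

text \<open>The bound by \<open>shape_end i (Suc r)\<close> gives \<open>i\<close> only to the top
  box of shape \<open>i\<close> in a column. Where row \<open>r + 1\<close> is empty this bound is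
  0, and \<open>r \<le> c\<close> excludes the columns left of the diagonal.\<close>

definition max_tableau :: "box \<Rightarrow> letter set" where
  "max_tableau = (\<lambda>(r, c).
     {Primed i | i. 1 \<le> i \<and> i \<le> n \<and> 1 \<le> r \<and> r \<le> primed_rows i \<and> c = first_col i r} \<union>
     {Unprimed i | i. 1 \<le> i \<and> i \<le> n \<and> 1 \<le> r \<and> r \<le> c \<and>
        shape_end i (Suc r) < c \<and> c \<le> shape_end i r \<and> first_col i r \<le> c})"

lemma Primed_in_max_tableau:
  "Primed i \<in> max_tableau (r, c) \<longleftrightarrow>
    1 \<le> i \<and> i \<le> n \<and> 1 \<le> r \<and> r \<le> primed_rows i \<and> c = first_col i r"
  by (auto simp: max_tableau_def)

lemma Unprimed_in_max_tableau:
  "Unprimed i \<in> max_tableau (r, c) \<longleftrightarrow> 1 \<le> i \<and> i \<le> n \<and> 1 \<le> r \<and> r \<le> c \<and>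
    shape_end i (Suc r) < c \<and> c \<le> shape_end i r \<and> first_col i r \<le> c"
  by (auto simp: max_tableau_def)

lemma max_tableau_memD:
  assumes "a \<in> max_tableau (r, c)"
  shows "1 \<le> idx a" "idx a \<le> n" "1 \<le> r" "r \<le> c" "c \<le> shape_end (idx a) r" "first_col (idx a) r \<le> c"
proof -
  have "1 \<le> idx a \<and> idx a \<le> n \<and> 1 \<le> r \<and> r \<le> c \<and> c \<le> shape_end (idx a) r \<and> first_col (idx a) r \<le> c"
  proof (cases a)
    case (Primed i)
    then have *: "1 \<le> i" "i \<le> n" "1 \<le> r" "r \<le> primed_rows i" "c = first_col i r"
      using assms by (simp_all add: Primed_in_max_tableau)
    then show ?thesis
      using Primed row_less_first_col[OF *(3,4,2)] first_col_bounds(3)[OF *(3,1,2)] by simp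
  next
    case (Unprimed i)
    then show ?thesis using assms by (simp add: Unprimed_in_max_tableau)
  qed
  then show "1 \<le> idx a" "idx a \<le> n" "1 \<le> r" "r \<le> c" "c \<le> shape_end (idx a) r" "first_col (idx a) r \<le> c"
    by simp_all
qed

lemma max_tableau_in_diagram:
  assumes "a \<in> max_tableau b"
  shows "b \<in> shifted_diagram lam"
proof -
  obtain r c where b: "b = (r, c)" by fastforce
  note a = max_tableau_memD[OF assms[unfolded b]]
  have "c \<le> shape_end n r" using shape_end_mono[of r "idx a" n] a by simp
  then show ?thesis
    using a shape_end_n[of r] unfolding b by (auto simp: diagram_iff split: if_splits)
qed

text \<open>A smaller index on the right would put \<open>(r, c + 1)\<close> into the shape before
  \<open>idx a\<close>, but letters of index \<open>idx a\<close> start no earlier than the row end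
  of that shape.\<close>

lemma max_tableau_right:
  assumes a: "a \<in> max_tableau (r, c)" and b: "b \<in> max_tableau (r, Suc c)"
  shows "a \<le> b" "is_primed a \<Longrightarrow> a \<noteq> b"
proof -
  note a' = max_tableau_memD[OF a] and b' = max_tableau_memD[OF b]
  have le: "idx a \<le> idx b"
  proof (rule ccontr)
    assume "\<not> idx a \<le> idx b"
    then have "shape_end (idx b) r \<le> shape_end (idx a - 1) r"
      using a' by (intro shape_end_mono) simp_all
    then show False using first_col_bounds(1)[of r "idx a"] a' b' by simp
  qed
  have np: "\<not> is_primed b" if "idx a = idx b"
    using that a' b by (cases b) (auto simp: Primed_in_max_tableau)
  show "a \<le> b" using le np by (cases a; cases b; cases "idx a = idx b") auto
  show "is_primed a \<Longrightarrow> a \<noteq> b" using np by auto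
qed

text \<open>If the upper index were smaller, rows \<open>r\<close> and \<open>r + 1\<close> of the
  shape before \<open>idx a\<close> would both end in column \<open>c\<close>. By
  \<open>shape_end_rim\<close> both would be row ends of \<Delta>, which are distinct.\<close>

lemma max_tableau_up:
  assumes a: "a \<in> max_tableau (r, c)" and b: "b \<in> max_tableau (Suc r, c)"
  shows "a \<le> b" "\<not> is_primed a \<Longrightarrow> a \<noteq> b"
proof -
  note a' = max_tableau_memD[OF a] and b' = max_tableau_memD[OF b]
  let ?i = "idx a"
  have le: "idx a \<le> idx b"
  proof (rule ccontr)
    assume "\<not> ?thesis"
    then have "shape_end (idx b) (Suc r) \<le> shape_end (?i - 1) (Suc r)"
      using a' by (intro shape_end_mono) simp_all
    moreover have "shape_end (?i - 1) (Suc r) \<le> shape_end (?i - 1) r"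
      using a' by (intro shape_end_Suc_row)
    moreover note first_col_bounds(1)[of r ?i]
    ultimately have c: "first_col ?i r = c" "shape_end (?i - 1) r = c" "shape_end (?i - 1) (Suc r) = c"
      using a' b' by simp_all
    moreover have "shape_end (?i - 1) (Suc r) \<le> shape_end ?i (Suc r)"
      using a' by (intro shape_end_pred) simp_all
    \<comment> \<open>The box above lies in shape \<open>?i\<close>, so \<open>first_col\<close> can
      equal the old row end only if row \<open>r\<close> does not grow.\<close>
    ultimately have top: "shape_end ?i r \<le> c" by (auto simp: first_col_def Let_def split: if_splits)
    have down: "shape_end ?i (Suc (Suc r)) \<le> shape_end ?i (Suc r)" "shape_end ?i (Suc r) \<le> shape_end ?i r"
      using a' shape_end_Suc_row by simp_all
    have pos: "0 < shape_end (?i - 1) r" "0 < shape_end (?i - 1) (Suc r)" using c a' by simp_all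
    have "c = hook_col r"
      by (rule shape_end_rim[OF a'(3,1,2) pos(1)]) (use c top down in simp_all)
    moreover have "c = hook_col (Suc r) \<and> Suc r \<le> p"
      by (rule shape_end_rim[OF _ a'(1,2) pos(2)]) (use c top down in simp_all)
    ultimately show False using hook_col_Suc[of r] a' by simp
  qed
  have np: "is_primed a" if "idx a = idx b"
    using that b' a by (cases a) (auto simp: Unprimed_in_max_tableau)
  show "a \<le> b" using le np by (cases a; cases b; cases "idx a = idx b") auto
  show "\<not> is_primed a \<Longrightarrow> a \<noteq> b" using np by auto
qed

text \<open>Let \<open>i\<close> be the step at which the box enters the shape. If the box above is
  not in shape \<open>i\<close>, the box contains \<open>i\<close>; otherwise
  \<open>shape_end_diagonal\<close> makes it the first new box of its row, and it contains
  \<open>i'\<close>.\<close>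

lemma max_tableau_nonempty:
  assumes "b \<in> shifted_diagram lam"
  shows "max_tableau b \<noteq> {}"
proof -
  obtain r c where b: "b = (r, c)" by fastforce
  then have rc: "1 \<le> r" "r \<le> q" "r \<le> c" "c \<le> row_end r" using assms by (simp_all add: diagram_iff)
  define i where "i = (LEAST i. c \<le> shape_end i r)"
  have "c \<le> shape_end n r" using rc by (simp add: shape_end_n)
  then have i: "c \<le> shape_end i r" "i \<le> n"
    unfolding i_def by (rule LeastI, rule Least_le)
  have "i \<noteq> 0" using i rc shape_end_0[of r] by (intro notI) simp
  then have "1 \<le> i" by simp
  have less: "shape_end (i - 1) r < c"
    using not_less_Least[of "i - 1" "\<lambda>i. c \<le> shape_end i r"] \<open>1 \<le> i\<close> unfolding i_def by linarith
  show ?thesis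
  proof (cases "shape_end i (Suc r) < c")
    case True
    have "first_col i r \<le> c" using first_col_bounds(2)[of r i] less rc i \<open>1 \<le> i\<close> by simp
    then have "Unprimed i \<in> max_tableau (r, c)"
      using True i \<open>1 \<le> i\<close> rc by (simp add: Unprimed_in_max_tableau)
    then show ?thesis using b by blast
  next
    case False
    then have "c = Suc (shape_end (i - 1) r)"
      using shape_end_diagonal[of r i] less rc i \<open>1 \<le> i\<close> by simp
    then have "c = first_col i r" using False i by (auto simp: first_col_def Let_def)
    moreover have "Suc r \<le> Suc (primed_rows i)"
      using False rc i by (intro shape_end_pos_row_le_primed_rows) simp_all
    ultimately have "Primed i \<in> max_tableau (r, c)"
      using i \<open>1 \<le> i\<close> rc by (simp add: Primed_in_max_tableau)
    then show ?thesis using b by blast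
  qed
qed

lemma finite_max_tableau: "finite (max_tableau b)"
proof (rule finite_subset[OF _ finite_letters[of n]])
  show "max_tableau b \<subseteq> {a. idx a \<le> n}"
    using max_tableau_memD(2) by (cases b) auto
qed

lemma max_tableau_in_PSVT: "max_tableau \<in> PSVT lam n"
proof -
  have Max: "Max (max_tableau b) \<in> max_tableau b" if "b \<in> shifted_diagram lam" for b
    using max_tableau_nonempty[OF that] finite_max_tableau by (rule Max_in[rotated])
  have Min: "Min (max_tableau b) \<in> max_tableau b" if "b \<in> shifted_diagram lam" for b
    using max_tableau_nonempty[OF that] finite_max_tableau by (rule Min_in[rotated])
  have right: "Max (max_tableau b) \<le> Min (max_tableau (box_right b)) \<and>
      (is_primed (Max (max_tableau b)) \<longrightarrow> Max (max_tableau b) < Min (max_tableau (box_right b)))"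
    if b: "b \<in> shifted_diagram lam" "box_right b \<in> shifted_diagram lam" for b
  proof -
    obtain r c where "b = (r, c)" by fastforce
    then show ?thesis
      using max_tableau_right[of "Max (max_tableau b)" r c "Min (max_tableau (box_right b))"]
        Max[OF b(1)] Min[OF b(2)] by (simp add: less_le del: Max_le_iff Min_ge_iff)
  qed
  have up: "Max (max_tableau b) \<le> Min (max_tableau (box_above b)) \<and>
      (\<not> is_primed (Max (max_tableau b)) \<longrightarrow> Max (max_tableau b) < Min (max_tableau (box_above b)))"
    if b: "b \<in> shifted_diagram lam" "box_above b \<in> shifted_diagram lam" for b
  proof -
    obtain r c where "b = (r, c)" by fastforce
    then show ?thesis
      using max_tableau_up[of "Max (max_tableau b)" r c "Min (max_tableau (box_above b))"]
        Max[OF b(1)] Min[OF b(2)] by (simp add: less_le del: Max_le_iff Min_ge_iff)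
  qed
  have diagonal: "\<not> is_primed a" if "a \<in> max_tableau (r, r)" for a r
    using that row_less_first_col[of r "idx a"] by (cases a) (auto simp: Primed_in_max_tableau)
  have idx: "1 \<le> idx a \<and> idx a \<le> n" if "a \<in> max_tableau b" for a b
    using that max_tableau_memD(1,2)[of a "fst b" "snd b"] by simp
  have empty: "max_tableau b = {}" if "b \<notin> shifted_diagram lam" for b
    using that max_tableau_in_diagram by blast
  show ?thesis
    unfolding PSVT_def P_shifted_svt_def
    using right up diagonal idx empty max_tableau_nonempty finite_max_tableau
    by (intro CollectI conjI ballI allI impI) blast+
qed

section \<open>Counting the entries of the extremal tableau\<close>

lemma card_Primed_max_tableau:
  assumes "1 \<le> i" "i \<le> n"
  shows "primed_rows i \<le> card {b. Primed i \<in> max_tableau b}"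
proof -
  have "(\<lambda>r. (r, first_col i r)) ` {1..primed_rows i} \<subseteq> {b. Primed i \<in> max_tableau b}"
    using assms by (auto simp: Primed_in_max_tableau)
  from card_mono[OF PSVT_finite_boxes[OF max_tableau_in_PSVT] this] show ?thesis
    by (simp add: card_image inj_on_def)
qed

text \<open>Row \<open>i\<close> is empty in shape \<open>i - 1\<close> and has nothing above it in
  shape \<open>i\<close>.\<close>

lemma Unprimed_in_own_row:
  assumes "1 \<le> i" "i \<le> p" "i \<le> c" "c \<le> hook_col i"
  shows "Unprimed i \<in> max_tableau (i, c)"
proof -
  have "i \<le> n" using assms p_le_q length_le by linarith
  then have "shape_end i (Suc i) = 0" "shape_end (i - 1) i = 0"
    using shape_end_pos_row_le[of i "Suc i"] shape_end_pos_row_le[of "i - 1" i] assms by fastforce+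
  then show ?thesis
    using assms \<open>i \<le> n\<close> shape_end_ge_hook_col[of i i] first_col_bounds(2)[of i i]
    by (simp add: Unprimed_in_max_tableau)
qed

text \<open>The witness is the top box of shape \<open>i\<close> in the end column of hook
  \<open>k\<close>; the bound on \<open>primed_rows i\<close> keeps it weakly right of the
  diagonal.\<close>

lemma Unprimed_in_column:
  assumes k: "1 \<le> k" "k \<le> p" and i: "k < i" "i \<le> n" and "primed_rows i < hook_col k"
  obtains t where "Unprimed i \<in> max_tableau (t, hook_col k)"
proof -
  let ?c = "hook_col k"
  let ?P = "\<lambda>m. shape_end i (Suc (k + m)) < ?c"
  have "?c \<noteq> 0" using hook_col_ge[OF k] k by linarith
  have "shape_end i (Suc (k + i)) = 0"
    using shape_end_pos_row_le[of i "Suc (k + i)"] i by fastforce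
  then have "?P i" using \<open>?c \<noteq> 0\<close> by simp
  define m where "m = (LEAST m. ?P m)"
  have above: "?P m" unfolding m_def by (rule LeastI[of ?P]) fact
  have ge: "?c \<le> shape_end i (k + m)"
  proof (cases m)
    case 0
    then show ?thesis using shape_end_ge_hook_col[of k i] k i by simp
  next
    case (Suc m')
    then have "\<not> ?P m'" using not_less_Least[of m' ?P] unfolding m_def by simp
    then show ?thesis using Suc by simp
  qed
  let ?t = "k + m"
  have "?t \<le> Suc (primed_rows i)"
    using ge \<open>?c \<noteq> 0\<close> i by (intro shape_end_pos_row_le_primed_rows) simp_all
  then have "?t \<le> ?c" using assms(5) by simp
  have "first_col i ?t \<le> ?c"
  proof (cases "0 < shape_end (i - 1) ?t")
    case False
    then show ?thesis using first_col_bounds(2)[of ?t i] k i \<open>?c \<noteq> 0\<close> by simp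
  next
    case True
    have *: "1 \<le> ?t" "1 \<le> i" using k i by simp_all
    note ub = first_col_bounds(2)[OF * i(2)]
    from * i(2) True show ?thesis
    proof (cases rule: shape_end_rim)
      case 1
      have "hook_col ?t \<le> ?c" using hook_col_less[of k ?t] k 1 by (cases "m = 0") auto
      \<comment> \<open>In the case of equality nothing of shape \<open>i\<close> lies above the old
        row end, so \<open>first_col\<close> is that end and not the next column.\<close>
      then consider "shape_end (i - 1) ?t < ?c" | "shape_end (i - 1) ?t = ?c" using 1 by linarith
      then show ?thesis using ub above by cases (auto simp: first_col_def Let_def)
    next
      case 2
      then show ?thesis using ub above by simp
    qed
  qed
  then have "Unprimed i \<in> max_tableau (?t, ?c)"
    using above ge \<open>?t \<le> ?c\<close> k i by (simp add: Unprimed_in_max_tableau)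
  then show ?thesis by (rule that)
qed

text \<open>Row \<open>i\<close> of \<Delta> and the end columns of earlier hooks are disjoint,
  since \<open>hook_col i < hook_col k\<close> for \<open>k < i\<close>.\<close>

lemma card_Unprimed_max_tableau:
  assumes "1 \<le> i" "i \<le> n"
  shows "(if i \<le> p then Suc (hook_col i) - i else 0) +
      card {k \<in> {1..p}. k < i \<and> primed_rows i < hook_col k}
    \<le> card {b. Unprimed i \<in> max_tableau b}"
proof -
  let ?K = "{k \<in> {1..p}. k < i \<and> primed_rows i < hook_col k}"
  define A where "A = (if i \<le> p then {i} \<times> {i..hook_col i} else {})"
  have "\<forall>k\<in>?K. \<exists>t. Unprimed i \<in> max_tableau (t, hook_col k)"
    using Unprimed_in_column[of _ i] assms by auto
  then obtain t where t: "\<And>k. k \<in> ?K \<Longrightarrow> Unprimed i \<in> max_tableau (t k, hook_col k)"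
    by metis
  let ?B = "(\<lambda>k. (t k, hook_col k)) ` ?K"
  have "inj_on (\<lambda>k. (t k, hook_col k)) ?K"
    using hook_col_inj by (auto simp: inj_on_def)
  then have B: "card ?B = card ?K" by (rule card_image)
  have A: "card A = (if i \<le> p then Suc (hook_col i) - i else 0)" "finite A"
    by (simp_all add: A_def)
  have "A \<inter> ?B = {}"
  proof (rule ccontr)
    assume "A \<inter> ?B \<noteq> {}"
    then obtain k where "k \<in> ?K" "(t k, hook_col k) \<in> A" by auto
    then show False using hook_col_less[of k i] by (auto simp: A_def split: if_splits)
  qed
  then have "card (A \<union> ?B) = card A + card ?B" using A by (intro card_Un_disjoint) auto
  moreover have "A \<union> ?B \<subseteq> {b. Unprimed i \<in> max_tableau b}"
    using t Unprimed_in_own_row assms by (auto simp: A_def split: if_splits)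
  from card_mono[OF PSVT_finite_boxes[OF max_tableau_in_PSVT] this]
  have "card (A \<union> ?B) \<le> card {b. Unprimed i \<in> max_tableau b}" .
  ultimately show ?thesis using A B by simp
qed

text \<open>Hook columns are distinct and exceed \<open>long_rows\<close>, so at most
  \<open>primed_rows i - long_rows\<close> hooks are lost, no more than the rows gained for
  \<open>i'\<close>. This matches the trade-off in \<open>letter_bound\<close>.\<close>

lemma card_long_hooks:
  shows "min p (i - 1) + min long_rows (i - 1)
    \<le> primed_rows i + card {k \<in> {1..p}. k < i \<and> primed_rows i < hook_col k}"
proof (cases "primed_rows i \<le> long_rows")
  case True
  then have "{k \<in> {1..p}. k < i \<and> primed_rows i < hook_col k} = {1..min p (i - 1)}"
    using long_rows_less_hook_col by fastforce
  then show ?thesis by (simp add: primed_rows_def)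
next
  case False
  then have i: "long_rows < i - 1" using primed_rows_le[of i] by simp
  let ?K = "{k \<in> {1..p}. k < i \<and> primed_rows i < hook_col k}"
  let ?L = "{k \<in> {1..p}. hook_col k \<le> primed_rows i}"
  have "{1..p} \<subseteq> ?K \<union> ?L" using i long_rows_bounds by auto
  then have "card {1..p} \<le> card (?K \<union> ?L)" by (intro card_mono) auto
  also have "\<dots> \<le> card ?K + card ?L" by (rule card_Un_le)
  also have "card ?L \<le> card {long_rows<..primed_rows i}"
    using long_rows_less_hook_col hook_col_inj by (intro card_inj_on_le[of hook_col]) (auto simp: inj_on_def)
  finally show ?thesis using False i long_rows_bounds by simp
qed

lemma tableau_degree_max_tableau:
  "sum_list \<Delta> + (\<Sum>i=1..n. min p (i - 1) + min long_rows (i - 1)) \<le> tableau_degree max_tableau"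
proof -
  let ?h = "\<lambda>i. if i \<le> p then Suc (hook_col i) - i else 0"
  have "p \<le> n" using p_le_q length_le by simp
  then have "(\<Sum>i=1..n. ?h i) = (\<Sum>i=1..p. Suc (hook_col i) - i)"
    by (intro sum.mono_neutral_cong_right) auto
  then have "sum_list \<Delta> + (\<Sum>i=1..n. min p (i - 1) + min long_rows (i - 1)) =
      (\<Sum>i=1..n. ?h i + (min p (i - 1) + min long_rows (i - 1)))"
    unfolding sum_list_\<Delta> sum.distrib by simp
  also have "\<dots> \<le> (\<Sum>i=1..n. tableau_content max_tableau i)"
  proof (rule sum_mono)
    fix i assume "i \<in> {1..n}"
    then have "1 \<le> i" "i \<le> n" by simp_all
    then show "?h i + (min p (i - 1) + min long_rows (i - 1)) \<le> tableau_content max_tableau i"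
      using card_long_hooks[of i] card_Unprimed_max_tableau[of i] card_Primed_max_tableau[of i]
      unfolding tableau_content_split[OF max_tableau_in_PSVT] by linarith
  qed
  finally show ?thesis by (simp add: tableau_degree_eq[OF max_tableau_in_PSVT])
qed

end

section \<open>The degree formula\<close>

text \<open>Reconciles the two bounds: for \<open>m = p \<le> n\<close> the difference is the
  summand \<open>p\<close> on the left of \<open>tableau_degree_le\<close>.\<close>

lemma sum_min_shift: "(\<Sum>i=1..n. min m i) = (\<Sum>i=1..n. min m (i - 1)) + min m (n :: nat)"
  by (induction n) auto

lemma sum_min:
  assumes "m \<le> (n :: nat)"
  shows "2 * (\<Sum>i=1..n. min m (i - 1)) + m * m + m = 2 * n * m"
  using assms
proof (induction n rule: dec_induct)
  case base
  have "(\<Sum>i=1..m. min m (i - 1)) = (\<Sum>i=1..m. i - 1)" by (rule sum.cong) auto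
  moreover have "2 * (\<Sum>i=1..m. i - 1) + m * m + m = 2 * m * m"
    by (induction m) (auto simp: algebra_simps)
  ultimately show ?case by simp
next
  case (step n)
  then show ?case by (simp add: algebra_simps)
qed

theorem theorem1p1:
  fixes lam \<Delta> :: "nat list" and n :: nat and \<beta> :: "'a::{idom, ring_char_0}"
  assumes "strict_partition lam"
    and "0 < n"
    and "length lam \<le> n"
    and "\<beta> \<noteq> 0"
    and "largest_D_partition_in lam \<Delta>"
  shows "(\<Delta> = [] \<or> last \<Delta> > 1 \<longrightarrow>
            int (mdegree (GP \<beta> lam n)) =
              int (sum_list \<Delta>) + 2 * int n * int (length \<Delta>) - int (length \<Delta>) ^ 2 - int (length \<Delta>)) \<and>
         (\<Delta> \<noteq> [] \<and> last \<Delta> = 1 \<longrightarrow>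
            int (mdegree (GP \<beta> lam n)) =
              int (sum_list \<Delta>) + 2 * int n * int (length \<Delta>) - int (length \<Delta>) ^ 2 - int n)"
proof -
  interpret largest_D_pair lam \<Delta> n
    using assms unfolding largest_D_partition_in_def by unfold_locales auto
  have "p \<le> n" using p_le_q length_le by simp
  define X where "X m = (\<Sum>i=1..n. min m (i - 1))" for m :: nat
  have X: "2 * int (X m) = 2 * int n * int m - int m ^ 2 - int m" if "m \<le> n" for m
    using arg_cong[OF sum_min[OF that], of int]
    by (simp add: X_def power2_eq_square algebra_simps)
  have "mdegree (GP \<beta> lam n) = sum_list \<Delta> + X p + X long_rows"
  proof (rule mdegree_GP_eqI[OF assms(4)])
    fix T assume "T \<in> PSVT lam n"
    then show "tableau_degree T \<le> sum_list \<Delta> + X p + X long_rows"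
      using tableau_degree_le[of T] sum_min_shift[of p n] \<open>p \<le> n\<close>
      by (simp add: X_def sum.distrib)
  next
    show "max_tableau \<in> PSVT lam n" by (rule max_tableau_in_PSVT)
    show "sum_list \<Delta> + X p + X long_rows \<le> tableau_degree max_tableau"
      using tableau_degree_max_tableau by (simp add: X_def sum.distrib)
  qed
  then have deg: "int (mdegree (GP \<beta> lam n)) = int (sum_list \<Delta>) + int (X p) + int (X long_rows)" by simp
  show ?thesis
  proof (intro conjI impI)
    assume "\<Delta> = [] \<or> last \<Delta> > 1"
    \<comment> \<open>The empty \<Delta> belongs here, with both numbers 0.\<close>
    then have "long_rows = p" by (auto simp: long_rows_def)
    then show "int (mdegree (GP \<beta> lam n)) =
        int (sum_list \<Delta>) + 2 * int n * int p - int p ^ 2 - int p"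
      using deg X[OF \<open>p \<le> n\<close>] by simp
  next
    assume "\<Delta> \<noteq> [] \<and> last \<Delta> = 1"
    then have "p = Suc long_rows" by (auto simp: long_rows_def)
    \<comment> \<open>The closed forms at \<open>p\<close> and \<open>p - 1\<close> are added in
      doubled form, which avoids halves.\<close>
    then have "2 * int (X p) + 2 * int (X long_rows) = 2 * (2 * int n * int p - int p ^ 2 - int n)"
      using X[of p] X[of long_rows] \<open>p \<le> n\<close> by (simp add: power2_eq_square algebra_simps)
    then have "int (X p) + int (X long_rows) = 2 * int n * int p - int p ^ 2 - int n" by presburger
    then show "int (mdegree (GP \<beta> lam n)) =
        int (sum_list \<Delta>) + 2 * int n * int p - int p ^ 2 - int n"
      using deg by simp
  qed
qed

end
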